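(* Consider the heterogeneous linear multi-agent system under DoS attacks over a Markovian random digraph, driven by the event-based algorithm with the dynamic event-triggered scheme, all as described in the context. Then the event-triggering instants $\{t_k^i\}$ determined by the scheme are such that no agent exhibits Zeno behavior; that is, for no agent $i\in\mathcal V$ is there a finite time $\mathcal T_0$ with $\lim_{k\to\infty}t_k^i=\mathcal T_0$.
   Context: **Agents.** $\mathcal V=\{1,\dots,N\}$; agent $i$ obeys $\dot x_i=A_ix_i+B_iu_i$, $y_i=C_ix_i$, with $x_i\in\mathbb R^{n_i}$, $u_i\in\mathbb R^{p_i}$, $y_i\in\mathbb R^q$; $(A_i,B_i)$ is controllable and $\mathrm{rank}\begin{bmatrix}C_iB_i&0_{q\times p_i}\\-A_iB_i&B_i\end{bmatrix}=n_i+q$. The auxiliary states are $\varrho_i,z_i\in\mathbb R^q$; $\alpha,\beta>0$ are constant gains; $K_i\in\mathbb R^{p_i\times n_i}$ is such that $A_i-B_iK_i$ is Hurwitz; $(U_i,W_i,X_i)$ solves $B_iU_i=A_iX_i$, $B_iW_i=X_i$, $C_iX_i=I_q$. **Costs.** The goal is to steer all outputs to the minimizer $\theta^*$ of $F(\theta)=\sum_{i=1}^Nf_i(\theta)$. *Assumption 1.* A minimizer $\theta^*\in\mathbb R^q$ of $F$ exists. *Assumption 2.* Each $f_i:\mathbb R^q\to\mathbb R$ is differentiable, strongly convex, i.e. there is $\iota_i>0$ with $(x-y)^T(\nabla f_i(x)-\nabla f_i(y))>\iota_i\|x-y\|^2$ for all $x\neq y$, and $\nabla f_i$ is locally Lipschitz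 on $\mathbb R^q$; the paper uses this in the form $\|\nabla f_i(x)-\nabla f_i(y)\|\le l_i\|x-y\|$ for all $x,y\in\mathbb R^q$ with a constant $l_i>0$. **Random digraph.** $r(t)$ is a right-continuous homogeneous Markov process with values in $\mathcal S=\{1,\dots,s\}$; it selects the digraph $\mathcal G(t)=\{\mathcal V,\mathcal E_{r(t)}\}$, with weights $a_{ij}(t)=a_{ij}^{r(t)}>0$ if $(j,i)\in\mathcal E_{r(t)}$ and $0$ otherwise, $\mathcal N_i(t)=\{j:(j,i)\in\mathcal E_{r(t)}\}$, and Laplacian $\mathcal L(t)$ with $l_{ii}=\sum_ja_{ij}$, $l_{ij}=-a_{ij}$ ($i\neq j$). *Assumption 3.* There is $\pi>0$ (entrywise) with $\mathcal L(t)\pi=\mathbf 0$ for all $t$, and there is $c>0$ such that, with $\mathcal L_p$ the Laplacian of digraph $p$, $\mathcal L_{un}=\sum_{p=1}^s\mathcal L_p$ and $\mathcal L_s=(\mathcal L_{un}+\mathcal L_{un}^T)/2$, one has $\sum_{i\in S,j\notin S}(-[\mathcal L_s]_{ij})\ge c$ for every nonempty proper $S\subset\mathcal V$. **DoS attacks.** The $m$-th attack occupies $\mathcal A_m=\{a_m\}\cup[a_m,a_m+\tau_m)$, $\tau_m\ge0$, $a_{m+1}>a_m+\tau_m$; $\Xi_a(t_0,t)=\bigcup_m\mathcal A_m\cap[t_0,t]$ is the set of times at which communication is denied, and $\Xi_s(t_0,t)=[t_0,t]\setminus\Xi_a(t_0,t)$. **Event-based algorithm.** Agent $i$ has transmission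 attempts $0=t_0^i<t_1^i<t_2^i<\cdots$. For $t\in[t_k^i,t_{k+1}^i)$, $$u_i=-K_ix_i-(U_i-K_iX_i)\varrho_i+W_i\vartheta_i,\quad \dot\varrho_i=\vartheta_i=-\nabla f_i(y_i)-\beta\bar e_{\varrho zi}-\alpha\beta\bar e_{yi},\quad\dot z_i=\alpha\beta\bar e_{yi},$$ where $\bar e_{\varrho zi}=e_{\varrho zi}$, $\bar e_{yi}=e_{yi}$ if $t_k^i\in\Xi_s(t_0,t)$ and $\bar e_{\varrho zi}=\bar e_{yi}=\mathbf 0$ if $t_k^i\in\Xi_a(t_0,t)$, with $e_{\varrho zi}=\sum_{j\in\mathcal N_i(t)}a_{ij}(t)(\hat\varrho_i-\hat\varrho_j+\hat z_i-\hat z_j)$, $e_{yi}=\sum_{j\in\mathcal N_i(t)}a_{ij}(t)(\hat y_i-\hat y_j)$; a hat denotes the value at the agent's own latest attempt instant, e.g. $\hat y_i(t)=y_i(t_k^i)$ for $t\in[t_k^i,t_{k+1}^i)$. **Event-triggered scheme.** Measurement errors: $\tilde e_{yi}=\hat y_i-y_i$, $\tilde e_{\varrho zi}=\hat\varrho_i+\hat z_i-(\varrho_i+z_i)$. Triggering functions: $g_i=\|\tilde e_{yi}\|^2-\theta_{gi}\|e_{yi}\|^2$, $h_i=\|\tilde e_{\varrho zi}\|^2-\theta_{hi}\|e_{\varrho zi}\|^2$, $\theta_{gi},\theta_{hi}\in[0,1)$. Next attempt: if $t_k^i\in\Xi_s(t_0,t)$, $t_{k+1}^i=\inf\{t>t_k^i:\sigma_{gi}g_i(t)\ge\eta_{gi}(t)\text{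 or }\sigma_{hi}h_i(t)\ge\eta_{hi}(t)\}$; if $t_k^i\in\Xi_a(t_0,t)$, $t_{k+1}^i=t_k^i+\kappa_k^i$ with a dwell time $\kappa_k^i>0$. Here $\sigma_{gi},\sigma_{hi}>0$, and with $\eta_{gi}(t_0),\eta_{hi}(t_0),k_{gi},k_{hi}>0$, $\delta_{gi},\delta_{hi}\in[0,1)$: on $[t_k^i,t_{k+1}^i)$, $\dot\eta_{gi}=-k_{gi}\eta_{gi}-\delta_{gi}g_i$ and $\dot\eta_{hi}=-k_{hi}\eta_{hi}-\delta_{hi}h_i$ if $t_k^i\in\Xi_s(t_0,t)$, while $\dot\eta_{gi}=\dot\eta_{hi}=0$ if $t_k^i\in\Xi_a(t_0,t)$.
   Formalization: For each agent the dwell times κ_k^i are assumed bounded below by a positive constant uniformly in k; with merely positive κ_k^i the claim fails, e.g. an attack on [0,3) with κ_k^i = 2^{-k} gives t_k^i → 2. *)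

theory Defs
  imports
    "HOL-Probability.Probability"
    "Jordan_Normal_Form.DL_Rank"
    "Jordan_Normal_Form.Char_Poly"
    "HOL-Library.Extended_Nat"
begin

text \<open>
  The dimensions of state and input differ from agent to agent, so vectors and matrices are those of
  \<open>Jordan_Normal_Form\<close>, whose dimensions are natural numbers; \<open>$\<close> and \<open>\<bullet>\<close> below refer to them.
  That vector type carries no topology, hence the explicit Euclidean norm, gradient and derivative.
\<close>

unbundle no vec_syntax
no_notation inner (infix \<open>\<bullet>\<close> 70)

definition enorm :: "real vec \<Rightarrow> real" where
  "enorm v = sqrt (v \<bullet> v)"

text \<open>\<open>df\<close> is the gradient of \<open>f\<close> on the whole of \<open>\<real>\<^sup>q\<close>, in the sense of Frechet differentiability.\<close>

definition has_gradient :: "nat \<Rightarrow> (real vec \<Rightarrow> real) \<Rightarrow> (real vec \<Rightarrow> real vec) \<Rightarrow> bool" where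
  "has_gradient q f df \<longleftrightarrow>
    (\<forall>x\<in>carrier_vec q. df x \<in> carrier_vec q \<and>
      (\<forall>\<epsilon>>0. \<exists>\<delta>>0. \<forall>h\<in>carrier_vec q. enorm h < \<delta> \<longrightarrow>
         \<bar>f (x + h) - f x - df x \<bullet> h\<bar> \<le> \<epsilon> * enorm h))"

definition vec_continuous_on :: "nat \<Rightarrow> real set \<Rightarrow> (real \<Rightarrow> real vec) \<Rightarrow> bool" where
  "vec_continuous_on d S v \<longleftrightarrow>
    (\<forall>t\<in>S. v t \<in> carrier_vec d) \<and> (\<forall>c<d. continuous_on S (\<lambda>t. v t $ c))"

definition vec_right_deriv :: "nat \<Rightarrow> (real \<Rightarrow> real vec) \<Rightarrow> real vec \<Rightarrow> real \<Rightarrow> bool" where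
  "vec_right_deriv d v v' t \<longleftrightarrow>
    (\<forall>c<d. ((\<lambda>s. v s $ c) has_real_derivative v' $ c) (at_right t))"

definition controllability_mat :: "nat \<Rightarrow> nat \<Rightarrow> real mat \<Rightarrow> real mat \<Rightarrow> real mat" where
  "controllability_mat n p A B = mat n (n * p) (\<lambda>(i, j). (A ^\<^sub>m (j div p) * B) $$ (i, j mod p))"

definition controllable :: "nat \<Rightarrow> nat \<Rightarrow> real mat \<Rightarrow> real mat \<Rightarrow> bool" where
  "controllable n p A B \<longleftrightarrow> vec_space.rank n (controllability_mat n p A B) = n"

definition hurwitz :: "real mat \<Rightarrow> bool" where
  "hurwitz A \<longleftrightarrow> (\<forall>l::complex. eigenvalue (map_mat complex_of_real A) l \<longrightarrow> Re l < 0)"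


record agent =
  dim_x :: nat
  dim_u :: nat
  matA :: "real mat"
  matB :: "real mat"
  matC :: "real mat"
  matK :: "real mat"
  matU :: "real mat"
  matW :: "real mat"
  matX :: "real mat"
  cost :: "real vec \<Rightarrow> real"
  grad :: "real vec \<Rightarrow> real vec"
  theta_g :: real
  theta_h :: real
  sigma_g :: real
  sigma_h :: real
  k_g :: real
  k_h :: real
  delta_g :: real
  delta_h :: real
  dwell :: "nat \<Rightarrow> real"

definition agent_plant :: "nat \<Rightarrow> agent \<Rightarrow> bool" where
  "agent_plant q P \<longleftrightarrow>
    matA P \<in> carrier_mat (dim_x P) (dim_x P) \<and>
    matB P \<in> carrier_mat (dim_x P) (dim_u P) \<and>
    matC P \<in> carrier_mat q (dim_x P) \<and>
    controllable (dim_x P) (dim_u P) (matA P) (matB P) \<and>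
    vec_space.rank (q + dim_x P)
      (four_block_mat (matC P * matB P) (0\<^sub>m q (dim_u P)) (- (matA P * matB P)) (matB P))
      = dim_x P + q"

definition agent_feedback :: "nat \<Rightarrow> agent \<Rightarrow> bool" where
  "agent_feedback q P \<longleftrightarrow>
    matK P \<in> carrier_mat (dim_u P) (dim_x P) \<and>
    hurwitz (matA P - matB P * matK P) \<and>
    matU P \<in> carrier_mat (dim_u P) q \<and>
    matW P \<in> carrier_mat (dim_u P) q \<and>
    matX P \<in> carrier_mat (dim_x P) q \<and>
    matB P * matU P = matA P * matX P \<and>
    matB P * matW P = matX P \<and>
    matC P * matX P = 1\<^sub>m q"

definition has_minimizer :: "nat \<Rightarrow> ('v::finite \<Rightarrow> agent) \<Rightarrow> bool" where
  "has_minimizer q ag \<longleftrightarrow>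
    (\<exists>\<theta>\<in>carrier_vec q. \<forall>v\<in>carrier_vec q.
       (\<Sum>i\<in>UNIV. cost (ag i) \<theta>) \<le> (\<Sum>i\<in>UNIV. cost (ag i) v))"

definition cost_regular :: "nat \<Rightarrow> agent \<Rightarrow> bool" where
  "cost_regular q P \<longleftrightarrow>
    has_gradient q (cost P) (grad P) \<and>
    (\<exists>\<iota>>0. \<forall>x\<in>carrier_vec q. \<forall>y\<in>carrier_vec q. x \<noteq> y \<longrightarrow>
       (x - y) \<bullet> (grad P x - grad P y) > \<iota> * (enorm (x - y))\<^sup>2) \<and>
    (\<exists>l>0. \<forall>x\<in>carrier_vec q. \<forall>y\<in>carrier_vec q.
       enorm (grad P x - grad P y) \<le> l * enorm (x - y))"

text \<open>
  Attempts made under attack are repeated after the dwell time \<open>\<kappa>\<^sub>k\<close>. The dwell times are positive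
  uniformly in \<open>k\<close>: with, say, \<open>\<kappa>\<^sub>k = 2\<^sup>-\<^sup>k\<close> the attempts would accumulate inside any attack interval
  of length at least \<open>2\<close> that covers the first of them.
\<close>

definition trigger_parameters :: "agent \<Rightarrow> bool" where
  "trigger_parameters P \<longleftrightarrow>
    theta_g P \<in> {0..<1} \<and> theta_h P \<in> {0..<1} \<and>
    sigma_g P > 0 \<and> sigma_h P > 0 \<and> k_g P > 0 \<and> k_h P > 0 \<and>
    delta_g P \<in> {0..<1} \<and> delta_h P \<in> {0..<1} \<and>
    (\<exists>\<kappa>>0. \<forall>k. dwell P k \<ge> \<kappa>)"


text \<open>
  \<open>E p\<close> is the edge set of digraph \<open>p\<close>, where \<open>(j, i)\<close> is an edge from \<open>j\<close> to \<open>i\<close>, and \<open>a p i j\<close> is the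
  weight of that edge.
\<close>

definition weighted_digraphs ::
  "('s \<Rightarrow> ('v \<times> 'v) set) \<Rightarrow> ('s \<Rightarrow> 'v \<Rightarrow> 'v \<Rightarrow> real) \<Rightarrow> bool" where
  "weighted_digraphs E a \<longleftrightarrow>
    (\<forall>p i j. ((j, i) \<in> E p \<longrightarrow> a p i j > 0) \<and> ((j, i) \<notin> E p \<longrightarrow> a p i j = 0))"

definition laplacian :: "('v::finite \<Rightarrow> 'v \<Rightarrow> real) \<Rightarrow> 'v \<Rightarrow> 'v \<Rightarrow> real" where
  "laplacian w i j = (if i = j then (\<Sum>k\<in>UNIV. w i k) else - w i j)"

definition union_laplacian ::
  "('s::finite \<Rightarrow> 'v::finite \<Rightarrow> 'v \<Rightarrow> real) \<Rightarrow> 'v \<Rightarrow> 'v \<Rightarrow> real" where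
  "union_laplacian a i j = (\<Sum>p\<in>UNIV. laplacian (a p) i j)"

definition sym_laplacian ::
  "('s::finite \<Rightarrow> 'v::finite \<Rightarrow> 'v \<Rightarrow> real) \<Rightarrow> 'v \<Rightarrow> 'v \<Rightarrow> real" where
  "sym_laplacian a i j = (union_laplacian a i j + union_laplacian a j i) / 2"

text \<open>
  The Markov property and homogeneity are expressed by the finite-dimensional distributions; written
  as a product, the equation also covers conditioning events of probability zero.
\<close>

definition homogeneous_markov :: "'w measure \<Rightarrow> (real \<Rightarrow> 'w \<Rightarrow> 's) \<Rightarrow> bool" where
  "homogeneous_markov M r \<longleftrightarrow>
    prob_space M \<and>
    (\<forall>t\<ge>0. r t \<in> measurable M (count_space UNIV)) \<and>
    (\<exists>P :: real \<Rightarrow> 's \<Rightarrow> 's \<Rightarrow> real.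
      \<forall>(n::nat) (ts :: nat \<Rightarrow> real) (ss :: nat \<Rightarrow> 's) h s'.
        0 \<le> ts 0 \<and> (\<forall>k<n. ts k < ts (Suc k)) \<and> 0 \<le> h \<longrightarrow>
        measure M {\<omega>\<in>space M. (\<forall>k\<le>n. r (ts k) \<omega> = ss k) \<and> r (ts n + h) \<omega> = s'}
        = measure M {\<omega>\<in>space M. \<forall>k\<le>n. r (ts k) \<omega> = ss k} * P h (ss n) s')"

definition right_continuous_paths :: "'w measure \<Rightarrow> (real \<Rightarrow> 'w \<Rightarrow> 's) \<Rightarrow> bool" where
  "right_continuous_paths M r \<longleftrightarrow>
    (\<forall>\<omega>\<in>space M. \<forall>t\<ge>0. eventually (\<lambda>u. r u \<omega> = r t \<omega>) (at_right t))"


text \<open>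
  There are \<open>m\<close> attacks, possibly none and possibly infinitely many; the \<open>l\<close>-th one starts at \<open>onset l\<close>
  and lasts for \<open>dur l\<close>.
\<close>

definition dos_attacks :: "enat \<Rightarrow> (nat \<Rightarrow> real) \<Rightarrow> (nat \<Rightarrow> real) \<Rightarrow> bool" where
  "dos_attacks m onset dur \<longleftrightarrow>
    (\<forall>l. enat l < m \<longrightarrow> 0 \<le> dur l) \<and>
    (\<forall>l. enat (Suc l) < m \<longrightarrow> onset l + dur l < onset (Suc l))"

definition Xi_a :: "enat \<Rightarrow> (nat \<Rightarrow> real) \<Rightarrow> (nat \<Rightarrow> real) \<Rightarrow> real \<Rightarrow> real \<Rightarrow> real set" where
  "Xi_a m onset dur t0 t = (\<Union>l\<in>{l. enat l < m}. {onset l} \<union> {onset l..<onset l + dur l}) \<inter> {t0..t}"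


text \<open>
  A trajectory lives on \<open>[0, horizon)\<close>, where \<open>horizon\<close> may be \<open>\<infinity>\<close>. A finite horizon has to be
  allowed: the closed loop is only defined as long as every agent has a latest attempt, so if the
  attempts of some agent accumulated at a finite time, the solution would end there. Attempts are
  extended reals, and \<open>\<infinity>\<close> means that there is no further attempt.
\<close>

record 'v trajectory =
  horizon :: ereal
  attempt :: "'v \<Rightarrow> nat \<Rightarrow> ereal"
  st_x :: "'v \<Rightarrow> real \<Rightarrow> real vec"
  st_rho :: "'v \<Rightarrow> real \<Rightarrow> real vec"
  st_z :: "'v \<Rightarrow> real \<Rightarrow> real vec"
  eta_g :: "'v \<Rightarrow> real \<Rightarrow> real"
  eta_h :: "'v \<Rightarrow> real \<Rightarrow> real"

definition life :: "'v trajectory \<Rightarrow> real set" where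
  "life X = {t. 0 \<le> t \<and> ereal t < horizon X}"

definition latest :: "(nat \<Rightarrow> ereal) \<Rightarrow> real \<Rightarrow> nat" where
  "latest ts t = (THE k. ts k \<le> ereal t \<and> ereal t < ts (Suc k))"

definition latest_time :: "'v trajectory \<Rightarrow> 'v \<Rightarrow> real \<Rightarrow> real" where
  "latest_time X i t = real_of_ereal (attempt X i (latest (attempt X i) t))"

definition agent_output :: "('v \<Rightarrow> agent) \<Rightarrow> 'v trajectory \<Rightarrow> 'v \<Rightarrow> real \<Rightarrow> real vec" where
  "agent_output ag X i t = matC (ag i) *\<^sub>v st_x X i t"

definition rho_z :: "'v trajectory \<Rightarrow> 'v \<Rightarrow> real \<Rightarrow> real vec" where
  "rho_z X i t = st_rho X i t + st_z X i t"

definition held :: "'v trajectory \<Rightarrow> ('v \<Rightarrow> real \<Rightarrow> real vec) \<Rightarrow> real \<Rightarrow> 'v \<Rightarrow> real vec" where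
  "held X v t i = v i (latest_time X i t)"

definition disagreement ::
  "nat \<Rightarrow> ('v \<times> 'v) set \<Rightarrow> ('v \<Rightarrow> 'v \<Rightarrow> real) \<Rightarrow> ('v \<Rightarrow> real vec) \<Rightarrow> 'v \<Rightarrow> real vec" where
  "disagreement q E w v i = vec q (\<lambda>c. \<Sum>j\<in>{j. (j, i) \<in> E}. w i j * (v i $ c - v j $ c))"

text \<open>
  Triggering function of agent \<open>i\<close> for a signal \<open>v\<close>, evaluated at time \<open>t\<close> as if \<open>s\<close> were the agent's
  latest attempt. Searching for the attempt after \<open>t\<^sub>k\<close> needs \<open>s = t\<^sub>k\<close> for all \<open>t > t\<^sub>k\<close>: with the
  agent's actual held value the measurement error is already reset to \<open>0\<close> at the attempt searched for.
  On \<open>[t\<^sub>k, t\<^sub>k\<^sub>+\<^sub>1)\<close> the two readings agree.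
\<close>

definition trigger_fun ::
  "nat \<Rightarrow> ('v \<times> 'v) set \<Rightarrow> ('v \<Rightarrow> 'v \<Rightarrow> real) \<Rightarrow> 'v trajectory \<Rightarrow> ('v \<Rightarrow> real \<Rightarrow> real vec)
    \<Rightarrow> real \<Rightarrow> 'v \<Rightarrow> real \<Rightarrow> real \<Rightarrow> real" where
  "trigger_fun q E w X v \<theta> i s t =
    (enorm (v i s - v i t))\<^sup>2
      - \<theta> * (enorm (disagreement q E w ((held X v t)(i := v i s)) i))\<^sup>2"

locale closed_loop =
  fixes q :: nat
    and ag :: "'v::finite \<Rightarrow> agent"
    and \<alpha> \<beta> :: real
    and E :: "'s \<Rightarrow> ('v \<times> 'v) set"
    and a :: "'s \<Rightarrow> 'v \<Rightarrow> 'v \<Rightarrow> real"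
    and r :: "real \<Rightarrow> 's"
    and \<Xi> :: "real \<Rightarrow> real \<Rightarrow> real set"
    and X :: "'v trajectory"
begin

definition secure :: "real \<Rightarrow> real \<Rightarrow> bool" where
  "secure s t \<longleftrightarrow> s \<in> {0..t} - \<Xi> 0 t"

definition e_rho_z :: "'v \<Rightarrow> real \<Rightarrow> real vec" where
  "e_rho_z i t = disagreement q (E (r t)) (a (r t)) (held X (rho_z X) t) i"

definition e_y :: "'v \<Rightarrow> real \<Rightarrow> real vec" where
  "e_y i t = disagreement q (E (r t)) (a (r t)) (held X (agent_output ag X) t) i"

definition bar_e_rho_z :: "'v \<Rightarrow> real \<Rightarrow> real vec" where
  "bar_e_rho_z i t = (if secure (latest_time X i t) t then e_rho_z i t else 0\<^sub>v q)"

definition bar_e_y :: "'v \<Rightarrow> real \<Rightarrow> real vec" where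
  "bar_e_y i t = (if secure (latest_time X i t) t then e_y i t else 0\<^sub>v q)"

definition vtheta :: "'v \<Rightarrow> real \<Rightarrow> real vec" where
  "vtheta i t =
    - grad (ag i) (agent_output ag X i t) - \<beta> \<cdot>\<^sub>v bar_e_rho_z i t - (\<alpha> * \<beta>) \<cdot>\<^sub>v bar_e_y i t"

definition control :: "'v \<Rightarrow> real \<Rightarrow> real vec" where
  "control i t =
    - (matK (ag i) *\<^sub>v st_x X i t)
    - (matU (ag i) - matK (ag i) * matX (ag i)) *\<^sub>v st_rho X i t
    + matW (ag i) *\<^sub>v vtheta i t"

definition g_fun :: "'v \<Rightarrow> real \<Rightarrow> real \<Rightarrow> real" where
  "g_fun i s t = trigger_fun q (E (r t)) (a (r t)) X (agent_output ag X) (theta_g (ag i)) i s t"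

definition h_fun :: "'v \<Rightarrow> real \<Rightarrow> real \<Rightarrow> real" where
  "h_fun i s t = trigger_fun q (E (r t)) (a (r t)) X (rho_z X) (theta_h (ag i)) i s t"

definition triggered :: "'v \<Rightarrow> real \<Rightarrow> real \<Rightarrow> bool" where
  "triggered i s t \<longleftrightarrow>
    sigma_g (ag i) * g_fun i s t \<ge> eta_g X i t \<or> sigma_h (ag i) * h_fun i s t \<ge> eta_h X i t"

text \<open>
  The right-hand sides jump at attempts of the neighbours and at switches of the digraph, but are
  continuous from the right, so solutions are continuous and satisfy the differential equations with
  right derivatives.
\<close>

definition state_equations :: bool where
  "state_equations \<longleftrightarrow>
    (\<forall>i. vec_continuous_on (dim_x (ag i)) (life X) (st_x X i) \<and>
         vec_continuous_on q (life X) (st_rho X i) \<and>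
         vec_continuous_on q (life X) (st_z X i) \<and>
         (\<forall>t\<in>life X.
            vec_right_deriv (dim_x (ag i)) (st_x X i)
              (matA (ag i) *\<^sub>v st_x X i t + matB (ag i) *\<^sub>v control i t) t \<and>
            vec_right_deriv q (st_rho X i) (vtheta i t) t \<and>
            vec_right_deriv q (st_z X i) ((\<alpha> * \<beta>) \<cdot>\<^sub>v bar_e_y i t) t))"

definition eta_equations :: bool where
  "eta_equations \<longleftrightarrow>
    (\<forall>i. eta_g X i 0 > 0 \<and> eta_h X i 0 > 0 \<and>
         continuous_on (life X) (eta_g X i) \<and> continuous_on (life X) (eta_h X i) \<and>
         (\<forall>t\<in>life X. let s = latest_time X i t in
            (eta_g X i has_real_derivative
              (if secure s t
               then - k_g (ag i) * eta_g X i t - delta_g (ag i) * g_fun i s t else 0)) (at_right t) \<and>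
            (eta_h X i has_real_derivative
              (if secure s t
               then - k_h (ag i) * eta_h X i t - delta_h (ag i) * h_fun i s t else 0)) (at_right t)))"

definition next_attempt :: "'v \<Rightarrow> nat \<Rightarrow> ereal" where
  "next_attempt i k = (let s = real_of_ereal (attempt X i k) in
     if secure s s
     then Inf (ereal ` {t\<in>life X. s < t \<and> triggered i s t})
     else ereal (s + dwell (ag i) k))"

definition attempt_scheme :: bool where
  "attempt_scheme \<longleftrightarrow>
    (\<forall>i. attempt X i 0 = 0 \<and>
         (\<forall>k. if attempt X i k < horizon X
              then attempt X i k < attempt X i (Suc k) \<and> attempt X i (Suc k) = next_attempt i k
              else attempt X i (Suc k) = \<infinity>) \<and>
         (\<forall>t\<in>life X. \<exists>k. attempt X i k \<le> ereal t \<and> ereal t < attempt X i (Suc k)))"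

definition execution :: bool where
  "execution \<longleftrightarrow> 0 < horizon X \<and> state_equations \<and> eta_equations \<and> attempt_scheme"

end

definition zeno :: "(nat \<Rightarrow> ereal) \<Rightarrow> bool" where
  "zeno ts \<longleftrightarrow> (\<exists>T0::real. ts \<longlonglongrightarrow> ereal T0)"

end

theory Submission
  imports Defs
begin

text \<open>
  Suppose the attempts of some agent accumulate at a finite time. Then the trajectory ends at a finite
  horizon \<open>T\<close>. Held values are past values of the states and the gradients are globally Lipschitz, so
  at each time the right-hand sides are bounded linearly in the supremum of the states over the past;
  hence the states are bounded, and Lipschitz continuous, on \<open>[0, T)\<close>. Between attempts the trigger
  condition fails, which gives \<open>\<eta>' \<ge> - (k + \<delta> / \<sigma>) \<eta>\<close>, so both thresholds stay above a positive
  constant on \<open>[0, T)\<close>. A triggering function is at most the squared distance a signal has travelled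
  since the last attempt, so reaching the threshold takes at least a fixed time. Attempts under attack
  are spaced by the dwell times, and therefore only finitely many attempts fit before \<open>T\<close>.
\<close>

section \<open>Functions with right derivatives\<close>

text \<open>The times up to which \<open>P\<close> has held throughout form an interval. By
  \<open>closed\<close> its supremum still satisfies \<open>P\<close>, and by \<open>step\<close> it
  cannot stop short of \<open>b\<close>. This replaces differential arguments that would need
  two-sided derivatives.\<close>

lemma real_induction:
  fixes a b :: real
  assumes "a \<le> b" and base: "P a"
    and closed: "\<And>c. a < c \<Longrightarrow> c \<le> b \<Longrightarrow> (\<And>s. a \<le> s \<Longrightarrow> s < c \<Longrightarrow> P s) \<Longrightarrow> P c"
    and step: "\<And>c. a \<le> c \<Longrightarrow> c < b \<Longrightarrow> (\<And>s. a \<le> s \<Longrightarrow> s \<le> c \<Longrightarrow> P s) \<Longrightarrow> eventually P (at_right c)"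
  shows "P b"
proof -
  define S where "S = {t\<in>{a..b}. \<forall>s\<in>{a..t}. P s}"
  define c where "c = Sup S"
  have aS: "a \<in> S"
    using \<open>a \<le> b\<close> base by (auto simp: S_def)
  have bdd: "bdd_above S"
    by (auto simp: S_def bdd_above_def)
  have ac: "a \<le> c"
    using aS bdd by (simp add: c_def cSup_upper)
  have cb: "c \<le> b"
    unfolding c_def using aS by (intro cSup_least) (auto simp: S_def)
  have before: "P s" if "a \<le> s" "s < c" for s
  proof -
    have "\<exists>t\<in>S. s < t"
      using that aS less_cSup_iff[OF _ bdd, of s] by (auto simp: c_def)
    then obtain t where "t \<in> S" "s < t"
      by blast
    then show ?thesis
      using that by (auto simp: S_def)
  qed
  have "P c"
    using closed[of c] before ac cb base by (cases "a = c") auto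
  then have upto: "P s" if "a \<le> s" "s \<le> c" for s
    using before that by (cases "s = c") auto
  have "c = b"
  proof (rule ccontr)
    assume "c \<noteq> b"
    then have "c < b"
      using cb by simp
    then obtain d where d: "c < d" "\<And>s. c < s \<Longrightarrow> s < d \<Longrightarrow> P s"
      using step[of c] ac upto by (auto simp: eventually_at_right_field)
    \<comment> \<open>This midpoint lies strictly beyond \<open>c\<close> but before both
      \<open>d\<close> and \<open>b\<close>, so it belongs to \<open>S\<close>, against
      \<open>c\<close> being its supremum.\<close>
    define t where "t = (c + min d b) / 2"
    have t: "c < t" "t < d" "t < b"
      using d(1) \<open>c < b\<close> by (auto simp: t_def)
    have "P s" if "a \<le> s" "s \<le> t" for s
      using upto[of s] d(2)[of s] that t by (cases "s \<le> c") auto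
    then have "t \<in> S"
      using t ac by (auto simp: S_def)
    then have "t \<le> c"
      using bdd by (simp add: c_def cSup_upper)
    then show False
      using t by simp
  qed
  then show ?thesis
    using \<open>P c\<close> by simp
qed

text \<open>A positive value persists to the right by continuity, and from the value zero a positive
  right derivative pushes the function up. This supplies the forward step of the real induction
  below.\<close>

lemma eventually_nonneg_at_right:
  fixes f :: "real \<Rightarrow> real"
  assumes deriv: "(f has_real_derivative D) (at_right c)"
    and "0 \<le> f c" and zero: "f c = 0 \<Longrightarrow> 0 < D"
  shows "eventually (\<lambda>s. 0 \<le> f s) (at_right c)"
proof (cases "f c = 0")
  case True
  obtain d where d: "d > 0" "\<And>h. h > 0 \<Longrightarrow> h < d \<Longrightarrow> f c < f (c + h)"
    using has_real_derivative_pos_inc_right[OF deriv zero[OF True]] by auto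
  have "0 \<le> f s" if "c < s" "s < c + d" for s
    using d(2)[of "s - c"] that True by simp
  then show ?thesis
    using d(1) by (auto simp: eventually_at_right_field intro!: exI[of _ "c + d"])
next
  case False
  have "(f \<longlongrightarrow> f c) (at_right c)"
    using DERIV_continuous[OF deriv] by (simp add: continuous_within)
  then have "eventually (\<lambda>s. 0 < f s) (at_right c)"
    using False assms(2) by (intro order_tendstoD) auto
  then show ?thesis
    by (rule eventually_mono) simp
qed

text \<open>Real induction on nonnegativity of the whole family: left limits give closedness, and
  finiteness of \<open>J\<close> merges the right neighbourhoods. The sign of the derivative matters
  only at a zero, and \<open>deriv\<close> may assume nonnegativity on all of \<open>[a, t]\<close>,
  which is what right-hand sides depending on the past require.\<close>

lemma right_deriv_barrier:
  fixes f :: "'j \<Rightarrow> real \<Rightarrow> real"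
  assumes "finite J" "a \<le> b"
    and cont: "\<And>j. j \<in> J \<Longrightarrow> continuous_on {a..b} (f j)"
    and init: "\<And>j. j \<in> J \<Longrightarrow> 0 \<le> f j a"
    and deriv: "\<And>t j. a \<le> t \<Longrightarrow> t < b \<Longrightarrow> (\<And>s j. a \<le> s \<Longrightarrow> s \<le> t \<Longrightarrow> j \<in> J \<Longrightarrow> 0 \<le> f j s) \<Longrightarrow> j \<in> J
      \<Longrightarrow> \<exists>D. (f j has_real_derivative D) (at_right t) \<and> (f j t = 0 \<longrightarrow> 0 < D)"
    and "j \<in> J"
  shows "0 \<le> f j b"
proof -
  have "\<forall>j\<in>J. 0 \<le> f j b"
  proof (rule real_induction[where a = a])
    fix c assume c: "a < c" "c \<le> b" and nonneg: "\<And>s. a \<le> s \<Longrightarrow> s < c \<Longrightarrow> \<forall>j\<in>J. 0 \<le> f j s"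
    show "\<forall>j\<in>J. 0 \<le> f j c"
    proof
      fix j assume j: "j \<in> J"
      have "continuous_on {a..c} (f j)"
        using cont[OF j] c by (auto intro: continuous_on_subset)
      then have "(f j \<longlongrightarrow> f j c) (at_left c)"
        using c(1) by (auto simp: continuous_on_Icc_at_leftD)
      moreover have "eventually (\<lambda>s. 0 \<le> f j s) (at_left c)"
        using nonneg j c by (auto simp: eventually_at_left_field intro!: exI[of _ a])
      ultimately show "0 \<le> f j c"
        by (rule tendsto_lowerbound) (simp add: trivial_limit_at_left_real)
    qed
  next
    fix c assume c: "a \<le> c" "c < b" and nonneg: "\<And>s. a \<le> s \<Longrightarrow> s \<le> c \<Longrightarrow> \<forall>j\<in>J. 0 \<le> f j s"
    have "eventually (\<lambda>s. 0 \<le> f j s) (at_right c)" if "j \<in> J" for j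
      using deriv[OF c _ that] nonneg that c by (auto intro: eventually_nonneg_at_right)
    then show "eventually (\<lambda>s. \<forall>j\<in>J. 0 \<le> f j s) (at_right c)"
      using \<open>finite J\<close> by (simp add: eventually_ball_finite)
  qed (use assms in auto)
  then show ?thesis
    using \<open>j \<in> J\<close> by blast
qed

corollary right_deriv_barrier_single:
  fixes f :: "real \<Rightarrow> real"
  assumes "a \<le> b" "continuous_on {a..b} f" "0 \<le> f a"
    and deriv: "\<And>t. a \<le> t \<Longrightarrow> t < b \<Longrightarrow> 0 \<le> f t \<Longrightarrow>
      \<exists>D. (f has_real_derivative D) (at_right t) \<and> (f t = 0 \<longrightarrow> 0 < D)"
  shows "0 \<le> f b"
  by (rule right_deriv_barrier[where f = "\<lambda>_. f" and J = "{()}" and a = a]) (use assms in auto)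

text \<open>The barrier needs a strictly positive derivative, so \<open>f\<close> is first tilted by
  a small slope \<open>\<delta>\<close>, which then tends to zero.\<close>

lemma right_deriv_nonneg_imp_mono:
  fixes f :: "real \<Rightarrow> real"
  assumes "a \<le> b" and cont: "continuous_on {a..b} f"
    and deriv: "\<And>t. a \<le> t \<Longrightarrow> t < b \<Longrightarrow> \<exists>D\<ge>0. (f has_real_derivative D) (at_right t)"
  shows "f a \<le> f b"
proof (rule field_le_epsilon)
  fix e :: real assume "0 < e"
  \<comment> \<open>The tilt adds at most \<open>e\<close> over \<open>[a, b]\<close>; the summand 1
    keeps the denominator positive when \<open>a = b\<close>.\<close>
  define \<delta> where "\<delta> = e / (b - a + 1)"
  have \<delta>: "\<delta> > 0" "\<delta> * (b - a) \<le> e"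
    using \<open>0 < e\<close> \<open>a \<le> b\<close> by (auto simp: \<delta>_def field_simps)
  have "0 \<le> f b - f a + \<delta> * (b - a)"
  proof (rule right_deriv_barrier_single[where a = a and f = "\<lambda>t. f t - f a + \<delta> * (t - a)"])
    fix t assume "a \<le> t" "t < b"
    then obtain D where D: "D \<ge> 0" "(f has_real_derivative D) (at_right t)"
      using deriv by blast
    have "((\<lambda>t. f t - f a + \<delta> * (t - a)) has_real_derivative D + \<delta>) (at_right t)"
      using D(2) by (auto intro!: derivative_eq_intros)
    then show "\<exists>D. ((\<lambda>t. f t - f a + \<delta> * (t - a)) has_real_derivative D) (at_right t) \<and>
        (f t - f a + \<delta> * (t - a) = 0 \<longrightarrow> 0 < D)"
      using D(1) \<delta>(1) by (intro exI[of _ "D + \<delta>"]) auto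
  qed (use cont \<open>a \<le> b\<close> in \<open>auto intro!: continuous_intros\<close>)
  then show "f a \<le> f b + e"
    using \<delta>(2) by simp
qed

text \<open>Both \<open>L * t + f t\<close> and \<open>L * t - f t\<close> have nonnegative right
  derivatives, hence are monotone.\<close>

lemma right_deriv_bounded_imp_lipschitz:
  fixes f :: "real \<Rightarrow> real"
  assumes "a \<le> b" and cont: "continuous_on {a..b} f"
    and deriv: "\<And>t. a \<le> t \<Longrightarrow> t < b \<Longrightarrow> \<exists>D. \<bar>D\<bar> \<le> L \<and> (f has_real_derivative D) (at_right t)"
  shows "\<bar>f b - f a\<bar> \<le> L * (b - a)"
proof -
  have "L * a + f a \<le> L * b + f b"
  proof (rule right_deriv_nonneg_imp_mono[where f = "\<lambda>t. L * t + f t"])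
    fix t assume "a \<le> t" "t < b"
    then obtain D where D: "\<bar>D\<bar> \<le> L" "(f has_real_derivative D) (at_right t)"
      using deriv by blast
    have "((\<lambda>t. L * t + f t) has_real_derivative L + D) (at_right t)"
      using D(2) by (auto intro!: derivative_eq_intros)
    then show "\<exists>D\<ge>0. ((\<lambda>t. L * t + f t) has_real_derivative D) (at_right t)"
      using D(1) by (intro exI[of _ "L + D"]) auto
  qed (use assms in \<open>auto intro!: continuous_intros\<close>)
  moreover have "L * a - f a \<le> L * b - f b"
  proof (rule right_deriv_nonneg_imp_mono[where f = "\<lambda>t. L * t - f t"])
    fix t assume "a \<le> t" "t < b"
    then obtain D where D: "\<bar>D\<bar> \<le> L" "(f has_real_derivative D) (at_right t)"
      using deriv by blast
    have "((\<lambda>t. L * t - f t) has_real_derivative L - D) (at_right t)"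
      using D(2) by (auto intro!: derivative_eq_intros)
    then show "\<exists>D\<ge>0. ((\<lambda>t. L * t - f t) has_real_derivative D) (at_right t)"
      using D(1) by (intro exI[of _ "L - D"]) auto
  qed (use assms in \<open>auto intro!: continuous_intros\<close>)
  ultimately show ?thesis
    by (simp add: algebra_simps abs_le_iff)
qed

text \<open>An exponential \<open>w\<close> with decay rate \<open>c + 1\<close> falls strictly
  faster than \<open>f\<close> is allowed to, so \<open>f\<close> cannot cross it: where they touch,
  \<open>f - w\<close> has derivative at least \<open>w > 0\<close>. On the bounded interval
  \<open>w\<close> stays above \<open>w T\<close>.\<close>

lemma right_deriv_positive_lower_bound:
  fixes f :: "real \<Rightarrow> real"
  assumes cont: "continuous_on {0..<T} f" and init: "0 < f 0" and "0 \<le> c"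
    and deriv: "\<And>t. 0 \<le> t \<Longrightarrow> t < T \<Longrightarrow> 0 \<le> f t \<Longrightarrow>
      \<exists>D\<ge>- c * f t. (f has_real_derivative D) (at_right t)"
  shows "\<exists>m>0. \<forall>t. 0 \<le> t \<longrightarrow> t < T \<longrightarrow> m \<le> f t"
proof -
  define w where "w t = f 0 / 2 * exp (- (c + 1) * t)" for t
  have w_pos: "0 < w t" for t
    using init by (simp add: w_def)
  have w_deriv: "(w has_real_derivative - (c + 1) * w t) (at_right t)" for t
    unfolding w_def by (auto intro!: derivative_eq_intros)
  have w_le: "w t \<le> f t" if t: "0 \<le> t" "t < T" for t
  proof -
    have "0 \<le> f t - w t"
    proof (rule right_deriv_barrier_single[where a = 0 and f = "\<lambda>t. f t - w t"])
      show "continuous_on {0..t} (\<lambda>t. f t - w t)"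
        unfolding w_def using t cont
        by (auto intro!: continuous_intros continuous_on_subset[OF cont])
      show "0 \<le> f 0 - w 0"
        using init by (simp add: w_def)
    next
      fix s assume "0 \<le> s" "s < t" "0 \<le> f s - w s"
      then have s: "0 \<le> s" "s < T" "w s \<le> f s"
        using t by auto
      then have "0 \<le> f s"
        using w_pos[of s] by simp
      then obtain D where D: "- c * f s \<le> D" "(f has_real_derivative D) (at_right s)"
        using deriv s by blast
      have "((\<lambda>t. f t - w t) has_real_derivative D - - (c + 1) * w s) (at_right s)"
        by (intro DERIV_diff D w_deriv)
      moreover have "0 < D - - (c + 1) * w s" if "f s - w s = 0"
      proof -
        have "- c * w s \<le> D"
          using D(1) that by simp
        then show ?thesis
          using w_pos[of s] by (simp add: algebra_simps)
      qed
      ultimately show "\<exists>D. ((\<lambda>t. f t - w t) has_real_derivative D) (at_right s) \<and> (f s - w s = 0 \<longrightarrow> 0 < D)"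
        by blast
    qed (use t in auto)
    then show ?thesis
      by simp
  qed
  have "w T \<le> w t" if "0 \<le> t" "t < T" for t
    using that init \<open>0 \<le> c\<close> by (auto simp: w_def intro!: mult_left_mono)
  then show ?thesis
    using w_le w_pos[of T] by (meson order_trans)
qed

section \<open>Linear growth bounds for vector-valued functions\<close>

text \<open>A bound in the maximum norm, chosen because the barrier argument works coordinate by
  coordinate. Including the carrier lets dimensions travel along with the estimates.\<close>

definition entries_le :: "nat \<Rightarrow> real \<Rightarrow> real vec \<Rightarrow> bool" where
  "entries_le d B v \<longleftrightarrow> v \<in> carrier_vec d \<and> (\<forall>c<d. \<bar>v $ c\<bar> \<le> B)"

lemma entries_le_mono: "entries_le d B v \<Longrightarrow> B \<le> B' \<Longrightarrow> entries_le d B' v"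
  by (force simp: entries_le_def)

lemma entries_le_add:
  assumes "entries_le d B v" "entries_le d B' w"
  shows "entries_le d (B + B') (v + w)"
  unfolding entries_le_def
proof (intro conjI allI impI)
  fix c assume "c < d"
  then have "\<bar>v $ c\<bar> \<le> B" "\<bar>w $ c\<bar> \<le> B'" "(v + w) $ c = v $ c + w $ c"
    using assms by (auto simp: entries_le_def)
  then show "\<bar>(v + w) $ c\<bar> \<le> B + B'"
    by linarith
qed (use assms in \<open>auto simp: entries_le_def\<close>)

lemma entries_le_uminus: "entries_le d B v \<Longrightarrow> entries_le d B (- v)"
  by (auto simp: entries_le_def)

lemma entries_le_smult:
  assumes "entries_le d B v"
  shows "entries_le d (\<bar>k\<bar> * B) (k \<cdot>\<^sub>v v)"
  unfolding entries_le_def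
proof (intro conjI allI impI)
  fix c assume "c < d"
  then have "\<bar>v $ c\<bar> \<le> B" "(k \<cdot>\<^sub>v v) $ c = k * v $ c"
    using assms by (auto simp: entries_le_def)
  then show "\<bar>(k \<cdot>\<^sub>v v) $ c\<bar> \<le> \<bar>k\<bar> * B"
    by (simp add: abs_mult mult_left_mono)
qed (use assms in \<open>auto simp: entries_le_def\<close>)

section \<open>Comparison of the Euclidean norm with entrywise bounds\<close>

lemma enorm_square: "(enorm v)\<^sup>2 = (\<Sum>c<dim_vec v. (v $ c)\<^sup>2)"
  by (simp add: enorm_def scalar_prod_def power2_eq_square sum_nonneg atLeast0LessThan)

lemma enorm_nonneg: "0 \<le> enorm v"
  by (simp add: enorm_def scalar_prod_def sum_nonneg)

lemma entry_le_enorm: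
  assumes "c < dim_vec v"
  shows "\<bar>v $ c\<bar> \<le> enorm v"
proof -
  have "(v $ c)\<^sup>2 \<le> (enorm v)\<^sup>2"
    unfolding enorm_square by (rule member_le_sum) (use assms in auto)
  then show ?thesis
    using enorm_nonneg abs_le_square_iff[of "v $ c" "enorm v"] by simp
qed

lemma enorm_square_le:
  assumes "entries_le d B v"
  shows "(enorm v)\<^sup>2 \<le> real d * B\<^sup>2"
proof -
  have "(v $ c)\<^sup>2 \<le> B\<^sup>2" if "c < d" for c
    using assms that by (force simp: entries_le_def intro: abs_le_square_iff[THEN iffD1])
  then have "(\<Sum>c<d. (v $ c)\<^sup>2) \<le> (\<Sum>c<d. B\<^sup>2)"
    by (intro sum_mono) simp
  then show ?thesis
    using assms by (auto simp: enorm_square entries_le_def)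
qed

lemma enorm_le:
  assumes "entries_le d B v" "0 \<le> B"
  shows "enorm v \<le> sqrt d * B"
proof -
  have "(enorm v)\<^sup>2 \<le> (sqrt d * B)\<^sup>2"
    using enorm_square_le[OF assms(1)] by (simp add: power_mult_distrib)
  then show ?thesis
    by (rule power2_le_imp_le) (use assms in auto)
qed

lemma entries_le_mult_mat_vec:
  assumes A: "A \<in> carrier_mat m n" and v: "entries_le n B v" and "0 \<le> B"
  shows "entries_le m ((\<Sum>i<m. \<Sum>j<n. \<bar>A $$ (i, j)\<bar>) * B) (A *\<^sub>v v)"
  unfolding entries_le_def
proof (intro conjI allI impI)
  show "A *\<^sub>v v \<in> carrier_vec m"
    using A v by (auto simp: entries_le_def)
  fix c assume c: "c < m"
  have "(A *\<^sub>v v) $ c = (\<Sum>j<n. A $$ (c, j) * v $ j)"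
    using A v c by (auto simp: scalar_prod_def entries_le_def atLeast0LessThan)
  also have "\<bar>\<dots>\<bar> \<le> (\<Sum>j<n. \<bar>A $$ (c, j)\<bar> * B)"
    using v by (intro order_trans[OF sum_abs] sum_mono) (auto simp: abs_mult entries_le_def intro!: mult_left_mono)
  also have "\<dots> = (\<Sum>j<n. \<bar>A $$ (c, j)\<bar>) * B"
    by (simp add: sum_distrib_right)
  also have "\<dots> \<le> (\<Sum>i<m. \<Sum>j<n. \<bar>A $$ (i, j)\<bar>) * B"
    using c \<open>0 \<le> B\<close>
    by (intro mult_right_mono member_le_sum[where f = "\<lambda>i. \<Sum>j<n. \<bar>A $$ (i, j)\<bar>"]) (auto intro: sum_nonneg)
  finally show "\<bar>(A *\<^sub>v v) $ c\<bar> \<le> (\<Sum>i<m. \<Sum>j<n. \<bar>A $$ (i, j)\<bar>) * B" .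
qed

text \<open>\<open>H t B\<close> is read as: the data on which \<open>F t\<close> depends are
  bounded by \<open>B\<close>. The constant \<open>C\<close> is uniform in \<open>t\<close> and
  \<open>B\<close>. Restricting to \<open>B \<ge> 1\<close> lets additive constants be absorbed, so
  affine growth also counts as linear.\<close>

definition linearly_bounded :: "('a \<Rightarrow> real \<Rightarrow> bool) \<Rightarrow> nat \<Rightarrow> ('a \<Rightarrow> real vec) \<Rightarrow> bool" where
  "linearly_bounded H d F \<longleftrightarrow> (\<exists>C\<ge>0. \<forall>t B. 1 \<le> B \<longrightarrow> H t B \<longrightarrow> entries_le d (C * B) (F t))"

lemma linearly_boundedI:
  "0 \<le> C \<Longrightarrow> (\<And>t B. 1 \<le> B \<Longrightarrow> H t B \<Longrightarrow> entries_le d (C * B) (F t)) \<Longrightarrow> linearly_bounded H d F"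
  by (auto simp: linearly_bounded_def)

lemma linearly_boundedE:
  assumes "linearly_bounded H d F"
  obtains C where "0 \<le> C" "\<And>t B. 1 \<le> B \<Longrightarrow> H t B \<Longrightarrow> entries_le d (C * B) (F t)"
  using assms by (auto simp: linearly_bounded_def)

text \<open>The index type is finite, so the sum of the individual constants serves all
  indices.\<close>

lemma linearly_bounded_uniform:
  fixes V :: "'k::finite \<Rightarrow> 'a \<Rightarrow> real vec"
  assumes "\<And>k. linearly_bounded H (d k) (V k)"
  obtains C where "0 \<le> C" "\<And>k t B. 1 \<le> B \<Longrightarrow> H t B \<Longrightarrow> entries_le (d k) (C * B) (V k t)"
proof -
  obtain C where C: "\<And>k. 0 \<le> C k" "\<And>k t B. 1 \<le> B \<Longrightarrow> H t B \<Longrightarrow> entries_le (d k) (C k * B) (V k t)"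
    using assms unfolding linearly_bounded_def by metis
  show thesis
  proof (rule that)
    show "0 \<le> sum C UNIV"
      using C(1) by (intro sum_nonneg) auto
    show "entries_le (d k) (sum C UNIV * B) (V k t)" if "1 \<le> B" "H t B" for k t B
    proof (rule entries_le_mono[OF C(2)[OF that]])
      have "C k \<le> sum C UNIV"
        by (rule member_le_sum) (use C(1) in auto)
      then show "C k * B \<le> sum C UNIV * B"
        using that(1) by (intro mult_right_mono) auto
    qed
  qed
qed

section \<open>Closure of linear growth under the operations occurring in the closed loop\<close>

lemma linearly_bounded_add:
  assumes "linearly_bounded H d F" "linearly_bounded H d G"
  shows "linearly_bounded H d (\<lambda>t. F t + G t)"
proof -
  obtain C D where "0 \<le> C" "\<And>t B. 1 \<le> B \<Longrightarrow> H t B \<Longrightarrow> entries_le d (C * B) (F t)"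
    and "0 \<le> D" "\<And>t B. 1 \<le> B \<Longrightarrow> H t B \<Longrightarrow> entries_le d (D * B) (G t)"
    using assms by (metis linearly_boundedE)
  then show ?thesis
    by (intro linearly_boundedI[of "C + D"]) (auto simp: distrib_right intro!: entries_le_add)
qed

lemma linearly_bounded_smult:
  assumes "linearly_bounded H d F"
  shows "linearly_bounded H d (\<lambda>t. k \<cdot>\<^sub>v F t)"
proof -
  obtain C where "0 \<le> C" "\<And>t B. 1 \<le> B \<Longrightarrow> H t B \<Longrightarrow> entries_le d (C * B) (F t)"
    using assms by (metis linearly_boundedE)
  then show ?thesis
    by (intro linearly_boundedI[of "\<bar>k\<bar> * C"]) (auto simp: mult.assoc intro!: entries_le_smult)
qed

lemma linearly_bounded_uminus:
  "linearly_bounded H d F \<Longrightarrow> linearly_bounded H d (\<lambda>t. - F t)"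
  unfolding linearly_bounded_def by (meson entries_le_uminus)

lemma linearly_bounded_minus:
  assumes "linearly_bounded H d F" "linearly_bounded H d G"
  shows "linearly_bounded H d (\<lambda>t. F t - G t)"
proof -
  \<comment> \<open>This holds without carrier assumptions: both sides take their dimension from
    \<open>G t\<close>.\<close>
  have "F t - G t = F t + - G t" for t
    by (rule eq_vecI) auto
  then show ?thesis
    using linearly_bounded_add[OF assms(1) linearly_bounded_uminus[OF assms(2)]] by simp
qed

lemma linearly_bounded_mult_mat_vec:
  assumes A: "A \<in> carrier_mat m n" and "linearly_bounded H n F"
  shows "linearly_bounded H m (\<lambda>t. A *\<^sub>v F t)"
proof -
  obtain C where C: "0 \<le> C" "\<And>t B. 1 \<le> B \<Longrightarrow> H t B \<Longrightarrow> entries_le n (C * B) (F t)"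
    using assms by (metis linearly_boundedE)
  show ?thesis
    using entries_le_mult_mat_vec[OF A C(2)] C(1)
    by (intro linearly_boundedI[of "(\<Sum>i<m. \<Sum>j<n. \<bar>A $$ (i, j)\<bar>) * C"])
      (auto simp: mult.assoc intro!: sum_nonneg mult_nonneg_nonneg)
qed

lemma linearly_bounded_if_zero:
  assumes "linearly_bounded H d F"
  shows "linearly_bounded H d (\<lambda>t. if b t then F t else 0\<^sub>v d)"
  using assms by (fastforce simp: linearly_bounded_def entries_le_def)

text \<open>Comparison with the origin: the Lipschitz condition bounds the difference from the
  gradient at zero, and that fixed gradient is absorbed because \<open>B \<ge> 1\<close>. The factor
  \<open>sqrt q\<close> converts the entrywise bound on \<open>F t\<close> to the Euclidean
  norm.\<close>

lemma linearly_bounded_gradient: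
  assumes cost: "cost_regular q P" and "linearly_bounded H q F"
  shows "linearly_bounded H q (\<lambda>t. grad P (F t))"
proof -
  obtain C where C: "0 \<le> C" "\<And>t B. 1 \<le> B \<Longrightarrow> H t B \<Longrightarrow> entries_le q (C * B) (F t)"
    using assms by (metis linearly_boundedE)
  obtain l where l: "l > 0" "\<And>x y. x \<in> carrier_vec q \<Longrightarrow> y \<in> carrier_vec q \<Longrightarrow>
      enorm (grad P x - grad P y) \<le> l * enorm (x - y)"
    using cost by (auto simp: cost_regular_def)
  have carr: "grad P x \<in> carrier_vec q" if "x \<in> carrier_vec q" for x
    using cost that by (auto simp: cost_regular_def has_gradient_def)
  define G where "G = enorm (grad P (0\<^sub>v q))"
  show ?thesis
  proof (rule linearly_boundedI)
    show "0 \<le> G + l * (sqrt q * C)"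
      using l(1) C(1) enorm_nonneg by (simp add: G_def)
    fix t B assume "1 \<le> B" "H t B"
    then have F: "entries_le q (C * B) (F t)"
      by (rule C(2))
    then have Fc: "F t \<in> carrier_vec q"
      by (simp add: entries_le_def)
    have "enorm (F t) \<le> sqrt q * (C * B)"
      using enorm_le[OF F] C(1) \<open>1 \<le> B\<close> by simp
    then have diff: "enorm (grad P (F t) - grad P (0\<^sub>v q)) \<le> l * (sqrt q * (C * B))"
      using l(2)[OF Fc, of "0\<^sub>v q"] l(1) Fc by (auto intro: order_trans mult_left_mono)
    show "entries_le q ((G + l * (sqrt q * C)) * B) (grad P (F t))"
      unfolding entries_le_def
    proof (intro conjI allI impI carr Fc)
      fix c assume c: "c < q"
      have "\<bar>(grad P (F t) - grad P (0\<^sub>v q)) $ c\<bar> \<le> l * (sqrt q * (C * B))"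
        using entry_le_enorm[of c "grad P (F t) - grad P (0\<^sub>v q)"] diff c carr[of "0\<^sub>v q"] by simp
      moreover have "(grad P (F t) - grad P (0\<^sub>v q)) $ c = grad P (F t) $ c - grad P (0\<^sub>v q) $ c"
        using c carr[of "0\<^sub>v q"] by simp
      moreover have "\<bar>grad P (0\<^sub>v q) $ c\<bar> \<le> G"
        unfolding G_def using c carr[of "0\<^sub>v q"] by (intro entry_le_enorm) simp
      moreover have "G \<le> G * B"
        using \<open>1 \<le> B\<close> enorm_nonneg[of "grad P (0\<^sub>v q)"] by (simp add: G_def mult_le_cancel_left1)
      ultimately show "\<bar>grad P (F t) $ c\<bar> \<le> (G + l * (sqrt q * C)) * B"
        by (simp add: algebra_simps abs_le_iff)
    qed
  qed
qed

text \<open>The active digraph \<open>p t\<close> may vary arbitrarily with \<open>t\<close>, but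
  there are only finitely many digraphs; \<open>W\<close> sums the weights into agent
  \<open>i\<close> over all of them, so the constant is independent of the switching.\<close>

lemma linearly_bounded_disagreement:
  fixes a :: "'s::finite \<Rightarrow> 'v::finite \<Rightarrow> 'v \<Rightarrow> real"
  assumes "\<And>j. linearly_bounded H q (V j)"
  shows "linearly_bounded H q (\<lambda>t. disagreement q (E (p t)) (a (p t)) (\<lambda>j. V j t) i)"
proof -
  obtain C where C: "0 \<le> C" "\<And>j t B. 1 \<le> B \<Longrightarrow> H t B \<Longrightarrow> entries_le q (C * B) (V j t)"
    using linearly_bounded_uniform[where V = V and d = "\<lambda>_. q", OF assms] by blast
  define W where "W = (\<Sum>p\<in>UNIV. \<Sum>j\<in>UNIV. \<bar>a p i j\<bar>)"
  show ?thesis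
  proof (rule linearly_boundedI)
    show "0 \<le> W * (2 * C)"
      using C(1) by (simp add: W_def sum_nonneg)
    fix t B assume B: "1 \<le> B" "H t B"
    show "entries_le q (W * (2 * C) * B) (disagreement q (E (p t)) (a (p t)) (\<lambda>j. V j t) i)"
      unfolding entries_le_def
    proof (intro conjI allI impI)
      fix c assume c: "c < q"
      have V: "\<bar>V j t $ c\<bar> \<le> C * B" for j
        using C(2)[OF B, of j] c by (simp add: entries_le_def)
      have "\<bar>\<Sum>j\<in>{j. (j, i) \<in> E (p t)}. a (p t) i j * (V i t $ c - V j t $ c)\<bar>
          \<le> (\<Sum>j\<in>{j. (j, i) \<in> E (p t)}. \<bar>a (p t) i j\<bar> * (2 * C * B))"
      proof (intro order_trans[OF sum_abs] sum_mono)
        fix j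
        have "\<bar>V i t $ c - V j t $ c\<bar> \<le> 2 * C * B"
          using V[of i] V[of j] by simp
        then show "\<bar>a (p t) i j * (V i t $ c - V j t $ c)\<bar> \<le> \<bar>a (p t) i j\<bar> * (2 * C * B)"
          by (simp add: abs_mult mult_left_mono)
      qed
      also have "\<dots> = (\<Sum>j\<in>{j. (j, i) \<in> E (p t)}. \<bar>a (p t) i j\<bar>) * (2 * C * B)"
        by (simp add: sum_distrib_right)
      also have "\<dots> \<le> W * (2 * C * B)"
      proof (rule mult_right_mono)
        have "(\<Sum>j\<in>{j. (j, i) \<in> E (p t)}. \<bar>a (p t) i j\<bar>) \<le> (\<Sum>j\<in>UNIV. \<bar>a (p t) i j\<bar>)"
          by (rule sum_mono2) auto
        also have "\<dots> \<le> W"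
          unfolding W_def
          by (rule member_le_sum[where f = "\<lambda>p. \<Sum>j\<in>UNIV. \<bar>a p i j\<bar>"]) (auto intro: sum_nonneg)
        finally show "(\<Sum>j\<in>{j. (j, i) \<in> E (p t)}. \<bar>a (p t) i j\<bar>) \<le> W" .
        show "0 \<le> 2 * C * B"
          using C(1) B(1) by simp
      qed
      finally show "\<bar>disagreement q (E (p t)) (a (p t)) (\<lambda>j. V j t) i $ c\<bar> \<le> W * (2 * C) * B"
        using c by (simp add: disagreement_def mult.assoc)
    qed (simp add: disagreement_def)
  qed
qed

text \<open>The bound covers the whole past \<open>[0, t]\<close> and not just the instant
  \<open>t\<close>, because the inputs of the closed loop contain held, that is delayed,
  values.\<close>

definition bounded_history ::
  "real \<Rightarrow> ('k \<Rightarrow> nat) \<Rightarrow> ('k \<Rightarrow> real \<Rightarrow> real vec) \<Rightarrow> real \<Rightarrow> real \<Rightarrow> bool" where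
  "bounded_history T d V t B \<longleftrightarrow>
    t \<in> {0..<T} \<and> (\<forall>s\<in>{0..t}. \<forall>k. entries_le (d k) B (V k s))"

lemma linearly_bounded_component: "linearly_bounded (bounded_history T d V) (d k) (V k)"
  by (rule linearly_boundedI[of 1]) (auto simp: bounded_history_def)

text \<open>A Gronwall estimate for delay equations: the right-hand side may depend on the whole past.\<close>

lemma bounded_of_linearly_bounded_deriv:
  fixes V V' :: "'k::finite \<Rightarrow> real \<Rightarrow> real vec"
  assumes cont: "\<And>k. vec_continuous_on (d k) {0..<T} (V k)"
    and deriv: "\<And>k t. t \<in> {0..<T} \<Longrightarrow> vec_right_deriv (d k) (V k) (V' k t) t"
    and growth: "\<And>k. linearly_bounded (bounded_history T d V) (d k) (V' k)"
  obtains B where "1 \<le> B" "\<And>k t. t \<in> {0..<T} \<Longrightarrow> entries_le (d k) B (V k t)"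
proof (cases "0 < T")
  case True
  obtain C where C: "0 \<le> C" "\<And>k t B. 1 \<le> B \<Longrightarrow> bounded_history T d V t B \<Longrightarrow> entries_le (d k) (C * B) (V' k t)"
    using linearly_bounded_uniform[where V = V' and d = d, OF growth] by blast
  have carr: "V k t \<in> carrier_vec (d k)" if "t \<in> {0..<T}" for k t
    using cont that by (auto simp: vec_continuous_on_def)
  \<comment> \<open>\<open>A\<close> dominates all initial values, and the summand 1 makes the
    comparison function below at least 1, as \<open>linearly_bounded\<close> demands.\<close>
  define A where "A = 1 + (\<Sum>k\<in>UNIV. enorm (V k 0))"
  have A: "1 \<le> A" "enorm (V k 0) \<le> A" for k
  proof -
    show "1 \<le> A"
      by (simp add: A_def sum_nonneg enorm_nonneg)
    have "enorm (V k 0) \<le> (\<Sum>k\<in>UNIV. enorm (V k 0))"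
      by (rule member_le_sum) (auto simp: enorm_nonneg)
    then show "enorm (V k 0) \<le> A"
      by (simp add: A_def)
  qed
  \<comment> \<open>The rate \<open>C + 1\<close> exceeds the growth constant \<open>C\<close>, so
    at a contact point \<open>w\<close> grows strictly faster than any coordinate of the
    states.\<close>
  define w where "w t = A * exp ((C + 1) * t)" for t
  have w_deriv: "(w has_real_derivative (C + 1) * w t) (at_right t)" for t
    unfolding w_def by (auto intro!: derivative_eq_intros)
  have w_mono: "w s \<le> w t" if "s \<le> t" for s t
    using that A(1) C(1) by (auto simp: w_def intro!: mult_left_mono)
  have w_ge: "1 \<le> w t" if "0 \<le> t" for t
  proof -
    have "1 \<le> w 0"
      using A(1) by (simp add: w_def)
    also have "\<dots> \<le> w t"
      by (rule w_mono[OF that])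
    finally show ?thesis .
  qed
  \<comment> \<open>An index consists of a component, a coordinate and a sign; nonnegativity for
    both signs says that the absolute value is at most \<open>w\<close>.\<close>
  define J where "J = (SIGMA k:UNIV. {..<d k} \<times> {-1, 1::real})"
  define f where "f j t = (case j of (k, c, e) \<Rightarrow> w t + e * V k t $ c)" for j t
  have V_le: "entries_le (d k) (w t) (V k t)" if t: "t \<in> {0..<T}" for k t
  proof -
    have "0 \<le> f j t" if "j \<in> J" for j
    proof (rule right_deriv_barrier[of J 0 t f])
      show "finite J"
        by (simp add: J_def)
      show "0 \<le> t"
        using t by simp
      fix j assume "j \<in> J"
      then obtain k c e where j: "j = (k, c, e)" "c < d k" "e \<in> {-1, 1}"
        by (auto simp: J_def)
      have "continuous_on {0..t} (\<lambda>t. V k t $ c)"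
        using cont[of k] j t by (auto simp: vec_continuous_on_def intro: continuous_on_subset)
      then show "continuous_on {0..t} (f j)"
        by (auto simp: f_def j w_def intro!: continuous_intros)
      have "\<bar>V k 0 $ c\<bar> \<le> A"
        using entry_le_enorm[of c "V k 0"] carr[of 0 k] A(2)[of k] j True by auto
      then show "0 \<le> f j 0"
        using j by (auto simp: f_def w_def)
    next
      fix s j
      assume s: "0 \<le> s" "s < t" and nonneg: "\<And>u j. 0 \<le> u \<Longrightarrow> u \<le> s \<Longrightarrow> j \<in> J \<Longrightarrow> 0 \<le> f j u"
        and "j \<in> J"
      then obtain k c e where j: "j = (k, c, e)" "c < d k" "e \<in> {-1, 1}"
        by (auto simp: J_def)
      \<comment> \<open>Since \<open>w\<close> is increasing, the barriers respected so far make
        \<open>w s\<close> a bound for the entire past, so \<open>growth\<close> applies with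
        \<open>B = w s\<close>.\<close>
      have "entries_le (d k) (w s) (V k u)" if u: "0 \<le> u" "u \<le> s" for k u
      proof (rule entries_le_mono[OF _ w_mono[OF u(2)]])
        show "entries_le (d k) (w u) (V k u)"
          unfolding entries_le_def
        proof (intro conjI allI impI)
          fix c assume "c < d k"
          then have "(k, c, -1) \<in> J" "(k, c, 1) \<in> J"
            by (auto simp: J_def)
          from this[THEN nonneg[OF u]] show "\<bar>V k u $ c\<bar> \<le> w u"
            by (simp add: f_def abs_le_iff)
        qed (use carr u s t in auto)
      qed
      then have "bounded_history T d V s (w s)"
        using s t by (auto simp: bounded_history_def)
      then have "\<bar>V' k s $ c\<bar> \<le> C * w s"
        using C(2)[of "w s" s k] w_ge[OF s(1)] j(2) by (simp add: entries_le_def)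
      then have "\<bar>e * V' k s $ c\<bar> \<le> C * w s"
        using j(3) by auto
      then have "0 < (C + 1) * w s + e * V' k s $ c"
        using w_ge[OF s(1)] by (simp add: distrib_right abs_le_iff)
      moreover have "((\<lambda>t. V k t $ c) has_real_derivative V' k s $ c) (at_right s)"
        using deriv[of s k] s t j(2) by (simp add: vec_right_deriv_def)
      then have "(f j has_real_derivative (C + 1) * w s + e * V' k s $ c) (at_right s)"
        unfolding f_def j prod.case by (intro DERIV_add w_deriv DERIV_cmult)
      ultimately show "\<exists>D. (f j has_real_derivative D) (at_right s) \<and> (f j s = 0 \<longrightarrow> 0 < D)"
        by blast
    qed (rule that)
    then have nonneg: "0 \<le> f (k, c, e) t" if "c < d k" "e \<in> {-1, 1}" for c e
      using that by (auto simp: J_def)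
    show ?thesis
      unfolding entries_le_def
    proof (intro conjI allI impI carr t)
      fix c assume "c < d k"
      then show "\<bar>V k t $ c\<bar> \<le> w t"
        using nonneg[of c 1] nonneg[of c "-1"] by (simp add: f_def abs_le_iff)
    qed
  qed
  show thesis
  proof (rule that)
    show "1 \<le> w T"
      using w_ge True by simp
    show "entries_le (d k) (w T) (V k t)" if "t \<in> {0..<T}" for k t
      using entries_le_mono[OF V_le[OF that] w_mono] that by simp
  qed
qed (use that[of 1] in auto)

text \<open>A bound on the states valid on all of \<open>[0, T)\<close> bounds every history at
  once, so the growth condition turns into a uniform bound on the right derivatives.\<close>

corollary lipschitz_of_linearly_bounded_deriv:
  fixes V V' :: "'k::finite \<Rightarrow> real \<Rightarrow> real vec"
  assumes cont: "\<And>k. vec_continuous_on (d k) {0..<T} (V k)"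
    and deriv: "\<And>k t. t \<in> {0..<T} \<Longrightarrow> vec_right_deriv (d k) (V k) (V' k t) t"
    and growth: "\<And>k. linearly_bounded (bounded_history T d V) (d k) (V' k)"
  obtains L where "0 \<le> L"
    "\<And>k s t. 0 \<le> s \<Longrightarrow> s \<le> t \<Longrightarrow> t < T \<Longrightarrow> entries_le (d k) (L * (t - s)) (V k s - V k t)"
proof -
  obtain B where B: "1 \<le> B" "\<And>k t. t \<in> {0..<T} \<Longrightarrow> entries_le (d k) B (V k t)"
    using bounded_of_linearly_bounded_deriv[where V = V and V' = V' and d = d, OF assms] by blast
  obtain C where C: "0 \<le> C" "\<And>k t B. 1 \<le> B \<Longrightarrow> bounded_history T d V t B \<Longrightarrow> entries_le (d k) (C * B) (V' k t)"
    using linearly_bounded_uniform[where V = V' and d = d, OF growth] by blast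
  have "bounded_history T d V t B" if "t \<in> {0..<T}" for t
    using B(2) that by (simp add: bounded_history_def)
  then have V': "\<bar>V' k t $ c\<bar> \<le> C * B" if "t \<in> {0..<T}" "c < d k" for k t c
    using C(2) B(1) that by (simp add: entries_le_def)
  show thesis
  proof (rule that)
    show "0 \<le> C * B"
      using B C by simp
    fix k and s t :: real assume st: "0 \<le> s" "s \<le> t" "t < T"
    have carr: "V k s \<in> carrier_vec (d k)" "V k t \<in> carrier_vec (d k)"
      using B(2) st by (auto simp: entries_le_def)
    have "\<bar>V k t $ c - V k s $ c\<bar> \<le> C * B * (t - s)" if c: "c < d k" for c
    proof (rule right_deriv_bounded_imp_lipschitz[where f = "\<lambda>t. V k t $ c"])
      show "continuous_on {s..t} (\<lambda>t. V k t $ c)"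
        using cont[of k] c st by (auto simp: vec_continuous_on_def intro: continuous_on_subset)
      show "\<exists>D. \<bar>D\<bar> \<le> C * B \<and> ((\<lambda>t. V k t $ c) has_real_derivative D) (at_right u)"
        if "s \<le> u" "u < t" for u
        using deriv[of u k] V'[of u c k] that st c
        by (intro exI[of _ "V' k u $ c"]) (auto simp: vec_right_deriv_def)
    qed (use st in simp)
    then show "entries_le (d k) (C * B * (t - s)) (V k s - V k t)"
      using carr by (auto simp: entries_le_def abs_minus_commute)
  qed
qed

section \<open>Executions\<close>

text \<open>A single sample path: \<open>r\<close> is a deterministic switching signal here.
  \<open>secure_iff\<close> states that whether an instant \<open>s\<close> is under attack does not
  depend on the later time \<open>t\<close> from which it is judged.\<close>

locale dos_execution = closed_loop q ag \<alpha> \<beta> E a r \<Xi> X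
  for q :: nat
    and ag :: "'v::finite \<Rightarrow> agent"
    and \<alpha> \<beta> :: real
    and E :: "'s::finite \<Rightarrow> ('v \<times> 'v) set"
    and a :: "'s \<Rightarrow> 'v \<Rightarrow> 'v \<Rightarrow> real"
    and r :: "real \<Rightarrow> 's"
    and \<Xi> :: "real \<Rightarrow> real \<Rightarrow> real set"
    and X :: "'v trajectory" +
  assumes plant: "agent_plant q (ag i)"
    and feedback: "agent_feedback q (ag i)"
    and costs: "cost_regular q (ag i)"
    and trigger: "trigger_parameters (ag i)"
    and secure_iff: "0 \<le> s \<Longrightarrow> s \<le> t \<Longrightarrow> secure s t \<longleftrightarrow> secure s s"
    and execution: execution
begin

lemma attempt_scheme: attempt_scheme
  using execution by (simp add: execution_def)

lemma attempt_0: "attempt X i 0 = 0"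
  using attempt_scheme by (simp add: attempt_scheme_def)

lemma attempt_Suc:
  assumes "attempt X i k < horizon X"
  shows "attempt X i k < attempt X i (Suc k)" "attempt X i (Suc k) = next_attempt i k"
  using attempt_scheme assms unfolding attempt_scheme_def by metis+

lemma attempt_Suc_infinity: "\<not> attempt X i k < horizon X \<Longrightarrow> attempt X i (Suc k) = \<infinity>"
  using attempt_scheme by (auto simp: attempt_scheme_def)

lemma attempt_covers: "t \<in> life X \<Longrightarrow> \<exists>k. attempt X i k \<le> ereal t \<and> ereal t < attempt X i (Suc k)"
  by (rule attempt_scheme[unfolded attempt_scheme_def, rule_format, THEN conjunct2, THEN conjunct2, rule_format])

lemma attempt_mono: "j \<le> k \<Longrightarrow> attempt X i j \<le> attempt X i k"
proof (rule lift_Suc_mono_le)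
  show "attempt X i k \<le> attempt X i (Suc k)" for k
    using attempt_Suc(1)[of i k] attempt_Suc_infinity[of i k]
    by (cases "attempt X i k < horizon X") auto
qed

lemma attempt_nonneg: "0 \<le> attempt X i k"
  using attempt_mono[of 0 k i] by (simp add: attempt_0)

end

text \<open>The situation into which an accumulation of attempts would force the execution. With
  \<open>T\<close> finite, exponential bounds become uniform on \<open>[0, T)\<close>.\<close>

locale finite_dos_execution = dos_execution q ag \<alpha> \<beta> E a r \<Xi> X
  for q :: nat
    and ag :: "'v::finite \<Rightarrow> agent"
    and \<alpha> \<beta> :: real
    and E :: "'s::finite \<Rightarrow> ('v \<times> 'v) set"
    and a :: "'s \<Rightarrow> 'v \<Rightarrow> 'v \<Rightarrow> real"
    and r :: "real \<Rightarrow> 's"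
    and \<Xi> :: "real \<Rightarrow> real \<Rightarrow> real set"
    and X :: "'v trajectory" +
  fixes T :: real
  assumes horizon: "horizon X = ereal T"
begin

lemma life_eq: "life X = {0..<T}"
  by (auto simp: life_def horizon)

text \<open>Covering gives an index and monotonicity makes it unique, so the definite description in
  \<open>latest\<close> is meaningful; the instant is finite because it lies between 0 and
  \<open>t\<close>.\<close>

lemma latest_attempt:
  assumes t: "t \<in> {0..<T}"
  shows "attempt X i (latest (attempt X i) t) = ereal (latest_time X i t)"
    and "0 \<le> latest_time X i t" and "latest_time X i t \<le> t"
    and "ereal t < attempt X i (Suc (latest (attempt X i) t))"
proof -
  obtain k where k: "attempt X i k \<le> ereal t" "ereal t < attempt X i (Suc k)"
    using attempt_covers[of t i] t by (auto simp: life_eq)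
  have unique: "j = k" if j: "attempt X i j \<le> ereal t" "ereal t < attempt X i (Suc j)" for j
  proof (rule ccontr)
    assume "j \<noteq> k"
    then consider "Suc j \<le> k" | "Suc k \<le> j"
      by linarith
    then show False
      using attempt_mono[of "Suc j" k i] attempt_mono[of "Suc k" j i] j k
      by cases (meson leD order_trans)+
  qed
  then have latest: "latest (attempt X i) t = k"
    unfolding latest_def using k unique by blast
  have "attempt X i k = ereal (latest_time X i t)"
    unfolding latest_time_def latest using attempt_nonneg[of i k] k(1)
    by (cases "attempt X i k") auto
  then show "attempt X i (latest (attempt X i) t) = ereal (latest_time X i t)"
    and "0 \<le> latest_time X i t" and "latest_time X i t \<le> t"
    and "ereal t < attempt X i (Suc (latest (attempt X i) t))"
    using k attempt_nonneg[of i k] by (auto simp: latest)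
qed

text \<open>If the condition held at \<open>t\<close>, then \<open>t\<close> would belong to the set
  whose infimum is the next attempt, which would thus come no later than \<open>t\<close>. The
  strict \<open>less\<close> is needed because that set excludes the latest attempt itself.\<close>

lemma not_triggered_since_latest:
  assumes t: "t \<in> {0..<T}" and less: "latest_time X i t < t" and sec: "secure (latest_time X i t) t"
  shows "\<not> triggered i (latest_time X i t) t"
proof
  assume trig: "triggered i (latest_time X i t) t"
  define k where "k = latest (attempt X i) t"
  define s where "s = latest_time X i t"
  note l = latest_attempt[OF t, of i, folded k_def s_def]
  have "attempt X i k < horizon X"
    using l t by (simp add: horizon)
  then have "attempt X i (Suc k) = Inf (ereal ` {t \<in> life X. s < t \<and> triggered i s t})"
    using attempt_Suc(2)[of i k] sec secure_iff[of s t] l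
    by (simp add: next_attempt_def flip: s_def)
  also have "\<dots> \<le> ereal t"
    using t less trig by (intro Inf_lower) (auto simp: life_eq s_def)
  finally show False
    using l(4) by simp
qed

text \<open>The three kinds of states of all agents are bundled into one family over a finite type,
  so that the Gronwall estimate treats the coupled system in one go.\<close>

abbreviation state :: "'v + 'v + 'v \<Rightarrow> real \<Rightarrow> real vec" where
  "state \<equiv> case_sum (st_x X) (case_sum (st_rho X) (st_z X))"

abbreviation state_dim :: "'v + 'v + 'v \<Rightarrow> nat" where
  "state_dim \<equiv> case_sum (\<lambda>i. dim_x (ag i)) (\<lambda>_. q)"

definition state_deriv :: "'v + 'v + 'v \<Rightarrow> real \<Rightarrow> real vec" where
  "state_deriv = case_sum (\<lambda>i t. matA (ag i) *\<^sub>v st_x X i t + matB (ag i) *\<^sub>v control i t)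
    (case_sum vtheta (\<lambda>i t. (\<alpha> * \<beta>) \<cdot>\<^sub>v bar_e_y i t))"

abbreviation history :: "real \<Rightarrow> real \<Rightarrow> bool" where
  "history \<equiv> bounded_history T state_dim state"

section \<open>Linear growth of the closed-loop right-hand sides\<close>

lemma linearly_bounded_states:
  "linearly_bounded history (dim_x (ag i)) (st_x X i)"
  "linearly_bounded history q (st_rho X i)"
  "linearly_bounded history q (st_z X i)"
  using linearly_bounded_component[of T state_dim state "Inl i"]
    linearly_bounded_component[of T state_dim state "Inr (Inl i)"]
    linearly_bounded_component[of T state_dim state "Inr (Inr i)"] by simp_all

lemma matrices:
  "matA (ag i) \<in> carrier_mat (dim_x (ag i)) (dim_x (ag i))"
  "matB (ag i) \<in> carrier_mat (dim_x (ag i)) (dim_u (ag i))"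
  "matC (ag i) \<in> carrier_mat q (dim_x (ag i))"
  "matK (ag i) \<in> carrier_mat (dim_u (ag i)) (dim_x (ag i))"
  "matW (ag i) \<in> carrier_mat (dim_u (ag i)) q"
  "matU (ag i) - matK (ag i) * matX (ag i) \<in> carrier_mat (dim_u (ag i)) q"
  using plant[of i] feedback[of i] by (auto simp: agent_plant_def agent_feedback_def)

text \<open>A bound on the history up to \<open>t\<close> is also one up to the earlier instant at
  which the value was sampled, so sampling costs nothing in the constant.\<close>

lemma linearly_bounded_held:
  assumes "linearly_bounded history q (v j)"
  shows "linearly_bounded history q (\<lambda>t. held X v t j)"
proof -
  obtain C where C: "0 \<le> C" "\<And>t B. 1 \<le> B \<Longrightarrow> history t B \<Longrightarrow> entries_le q (C * B) (v j t)"
    using assms by (metis linearly_boundedE)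
  show ?thesis
  proof (rule linearly_boundedI[OF C(1)])
    fix t B assume B: "1 \<le> B" and hist: "history t B"
    then have "t \<in> {0..<T}"
      by (simp add: bounded_history_def)
    then have "history (latest_time X j t) B"
      using hist latest_attempt(2,3)[of t j] by (auto simp: bounded_history_def)
    then show "entries_le q (C * B) (held X v t j)"
      unfolding held_def using C(2) B by blast
  qed
qed

lemma linearly_bounded_output: "linearly_bounded history q (agent_output ag X i)"
  unfolding agent_output_def[abs_def]
  by (intro linearly_bounded_mult_mat_vec[OF matrices(3)] linearly_bounded_states)

lemma linearly_bounded_rho_z: "linearly_bounded history q (rho_z X i)"
  unfolding rho_z_def[abs_def] by (intro linearly_bounded_add linearly_bounded_states)

lemma linearly_bounded_bar_e:
  "linearly_bounded history q (bar_e_rho_z i)" "linearly_bounded history q (bar_e_y i)"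
  unfolding bar_e_rho_z_def[abs_def] bar_e_y_def[abs_def] e_rho_z_def e_y_def
  by (intro linearly_bounded_if_zero linearly_bounded_disagreement linearly_bounded_held
      linearly_bounded_output linearly_bounded_rho_z)+

lemma linearly_bounded_vtheta: "linearly_bounded history q (vtheta i)"
  unfolding vtheta_def[abs_def]
  by (intro linearly_bounded_minus linearly_bounded_uminus linearly_bounded_smult
      linearly_bounded_gradient costs linearly_bounded_output linearly_bounded_bar_e)

lemma linearly_bounded_control: "linearly_bounded history (dim_u (ag i)) (control i)"
  unfolding control_def[abs_def]
  by (intro linearly_bounded_add linearly_bounded_minus linearly_bounded_uminus
      linearly_bounded_mult_mat_vec[OF matrices(4)] linearly_bounded_mult_mat_vec[OF matrices(5)]
      linearly_bounded_mult_mat_vec[OF matrices(6)] linearly_bounded_states linearly_bounded_vtheta)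

lemma linearly_bounded_state_deriv: "linearly_bounded history (state_dim k) (state_deriv k)"
proof -
  have "linearly_bounded history (dim_x (ag i))
      (\<lambda>t. matA (ag i) *\<^sub>v st_x X i t + matB (ag i) *\<^sub>v control i t)" for i
    by (intro linearly_bounded_add linearly_bounded_mult_mat_vec[OF matrices(1)]
        linearly_bounded_mult_mat_vec[OF matrices(2)] linearly_bounded_states linearly_bounded_control)
  then show ?thesis
    by (auto simp: state_deriv_def linearly_bounded_vtheta linearly_bounded_bar_e
        intro: linearly_bounded_smult split: sum.split)
qed

lemma signals_lipschitz:
  obtains L where "0 \<le> L"
    "\<And>i s t. 0 \<le> s \<Longrightarrow> s \<le> t \<Longrightarrow> t < T \<Longrightarrow>
      entries_le q (L * (t - s)) (agent_output ag X i s - agent_output ag X i t)"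
    "\<And>i s t. 0 \<le> s \<Longrightarrow> s \<le> t \<Longrightarrow> t < T \<Longrightarrow> entries_le q (L * (t - s)) (rho_z X i s - rho_z X i t)"
proof -
  have eqs: state_equations
    using execution by (simp add: execution_def)
  have cont: "vec_continuous_on (state_dim k) {0..<T} (state k)" for k
    using eqs by (auto simp: state_equations_def life_eq split: sum.split)
  have "vec_right_deriv (state_dim k) (state k) (state_deriv k t) t" if "t \<in> {0..<T}" for k t
    using eqs that by (auto simp: state_equations_def life_eq state_deriv_def split: sum.split)
  then obtain L where L: "0 \<le> L" "\<And>k s t. 0 \<le> s \<Longrightarrow> s \<le> t \<Longrightarrow> t < T \<Longrightarrow>
      entries_le (state_dim k) (L * (t - s)) (state k s - state k t)"
    using lipschitz_of_linearly_bounded_deriv[where V = state and d = state_dim and V' = state_deriv,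
        OF cont _ linearly_bounded_state_deriv] by blast
  define N where "N i = (\<Sum>c<q. \<Sum>j<dim_x (ag i). \<bar>matC (ag i) $$ (c, j)\<bar>)" for i
  \<comment> \<open>One factor for both signals: it dominates the size of every output matrix, and
    the 2 accounts for adding the increments of \<open>\<rho>\<close> and \<open>z\<close>.\<close>
  define M where "M = sum N UNIV + 2"
  have N: "0 \<le> N i" for i
    by (simp add: N_def sum_nonneg)
  have M: "N i \<le> M" "2 \<le> M" for i
    using member_le_sum[of i UNIV N] sum_nonneg[of UNIV N] N by (auto simp: M_def intro: add_increasing2)
  show thesis
  proof (rule that)
    show "0 \<le> M * L"
      using L(1) M(2) by simp
    fix i and s t :: real assume st: "0 \<le> s" "s \<le> t" "t < T"
    have carr: "st_x X i u \<in> carrier_vec (dim_x (ag i))" "st_rho X i u \<in> carrier_vec q"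
      "st_z X i u \<in> carrier_vec q" if "u \<in> {0..<T}" for u
      using cont[of "Inl i"] cont[of "Inr (Inl i)"] cont[of "Inr (Inr i)"] that
      by (auto simp: vec_continuous_on_def)
    have nn: "0 \<le> L * (t - s)"
      using L(1) st by simp
    have "entries_le q (N i * (L * (t - s))) (matC (ag i) *\<^sub>v (st_x X i s - st_x X i t))"
      unfolding N_def using L(2)[OF st, of "Inl i"] nn by (intro entries_le_mult_mat_vec matrices) auto
    moreover have "matC (ag i) *\<^sub>v (st_x X i s - st_x X i t) = agent_output ag X i s - agent_output ag X i t"
      unfolding agent_output_def using st by (intro mult_minus_distrib_mat_vec[OF matrices(3)] carr) auto
    moreover have "N i * (L * (t - s)) \<le> M * L * (t - s)"
      using mult_right_mono[OF M(1) nn] by (simp add: mult.assoc)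
    ultimately show "entries_le q (M * L * (t - s)) (agent_output ag X i s - agent_output ag X i t)"
      using entries_le_mono by metis
    have "entries_le q (L * (t - s) + L * (t - s))
        ((st_rho X i s - st_rho X i t) + (st_z X i s - st_z X i t))"
      using L(2)[OF st, of "Inr (Inl i)"] L(2)[OF st, of "Inr (Inr i)"] by (intro entries_le_add) auto
    moreover have "(st_rho X i s - st_rho X i t) + (st_z X i s - st_z X i t) = rho_z X i s - rho_z X i t"
      unfolding rho_z_def using carr[of s] carr[of t] st by (intro eq_vecI) auto
    moreover have "L * (t - s) + L * (t - s) \<le> M * L * (t - s)"
      using mult_right_mono[OF M(2) nn] by (simp add: mult.assoc)
    ultimately show "entries_le q (M * L * (t - s)) (rho_z X i s - rho_z X i t)"
      using entries_le_mono by metis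
  qed
qed

text \<open>The subtracted disagreement term is nonnegative, so dropping it leaves the squared
  measurement error alone. The Lipschitz estimate then gives a quadratic bound that is independent
  of neighbours and digraph.\<close>

lemma trigger_functions_le:
  obtains K where "0 \<le> K"
    "\<And>i s t. 0 \<le> s \<Longrightarrow> s \<le> t \<Longrightarrow> t < T \<Longrightarrow> g_fun i s t \<le> K * (t - s)\<^sup>2"
    "\<And>i s t. 0 \<le> s \<Longrightarrow> s \<le> t \<Longrightarrow> t < T \<Longrightarrow> h_fun i s t \<le> K * (t - s)\<^sup>2"
proof -
  obtain L where L: "0 \<le> L"
    "\<And>i s t. 0 \<le> s \<Longrightarrow> s \<le> t \<Longrightarrow> t < T \<Longrightarrow>
      entries_le q (L * (t - s)) (agent_output ag X i s - agent_output ag X i t)"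
    "\<And>i s t. 0 \<le> s \<Longrightarrow> s \<le> t \<Longrightarrow> t < T \<Longrightarrow> entries_le q (L * (t - s)) (rho_z X i s - rho_z X i t)"
    using signals_lipschitz by blast
  have le: "trigger_fun q E' w X v \<theta> i s t \<le> q * L\<^sup>2 * (t - s)\<^sup>2"
    if "0 \<le> \<theta>" "entries_le q (L * (t - s)) (v i s - v i t)"
    for E' w v \<theta> i s t
  proof -
    have "0 \<le> \<theta> * (enorm (disagreement q E' w ((held X v t)(i := v i s)) i))\<^sup>2"
      using that(1) by simp
    then show ?thesis
      using enorm_square_le[OF that(2)] by (simp add: trigger_fun_def power_mult_distrib mult.assoc)
  qed
  have \<theta>: "0 \<le> theta_g (ag i)" "0 \<le> theta_h (ag i)" for i
    using trigger[of i] by (auto simp: trigger_parameters_def)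
  show thesis
    by (rule that[of "q * L\<^sup>2"]) (auto simp: g_fun_def h_fun_def intro!: le \<theta> L(2,3))
qed

text \<open>Stated for an abstract pair of threshold \<open>\<eta>\<close> and triggering function
  \<open>\<phi>\<close>, since it is applied to both channels. During a hold begun under attack the
  derivative is zero, which satisfies the same differential inequality.\<close>

lemma threshold_lower_bound:
  assumes cont: "continuous_on {0..<T} \<eta>" and "0 < \<eta> 0"
    and params: "0 < k" "0 \<le> \<delta>" "0 < \<sigma>"
    and deriv: "\<And>t. t \<in> {0..<T} \<Longrightarrow> (\<eta> has_real_derivative
      (if secure (latest_time X i t) t then - k * \<eta> t - \<delta> * \<phi> (latest_time X i t) t else 0)) (at_right t)"
    and reset: "\<And>t. t \<in> {0..<T} \<Longrightarrow> \<phi> t t \<le> 0"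
    and untriggered: "\<And>s t. \<not> triggered i s t \<Longrightarrow> \<sigma> * \<phi> s t < \<eta> t"
  shows "\<exists>m>0. \<forall>t. 0 \<le> t \<longrightarrow> t < T \<longrightarrow> m \<le> \<eta> t"
proof (rule right_deriv_positive_lower_bound[where c = "k + \<delta> / \<sigma>"])
  show "0 \<le> k + \<delta> / \<sigma>"
    using params by simp
  fix t assume t: "0 \<le> t" "t < T" and nn: "0 \<le> \<eta> t"
  define s where "s = latest_time X i t"
  have "\<phi> s t \<le> \<eta> t / \<sigma>" if sec: "secure s t"
  proof (cases "s = t")
    case True
    then have "\<phi> s t \<le> 0"
      using reset t by simp
    also have "0 \<le> \<eta> t / \<sigma>"
      using nn params by simp
    finally show ?thesis .
  next
    case False
    then have "\<not> triggered i s t"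
      using not_triggered_since_latest[of t i] sec t latest_attempt(3)[of t i] by (simp add: s_def)
    then have "\<sigma> * \<phi> s t < \<eta> t"
      by (rule untriggered)
    then show ?thesis
      using params by (simp add: field_simps)
  qed
  then have "\<delta> * \<phi> s t \<le> \<delta> * (\<eta> t / \<sigma>)" if "secure s t"
    using that params by (intro mult_left_mono) auto
  moreover have "0 \<le> (k + \<delta> / \<sigma>) * \<eta> t"
    using params nn by simp
  ultimately have "- (k + \<delta> / \<sigma>) * \<eta> t \<le> (if secure s t then - k * \<eta> t - \<delta> * \<phi> s t else 0)"
    by (auto simp: algebra_simps)
  moreover have "(\<eta> has_real_derivative
      (if secure s t then - k * \<eta> t - \<delta> * \<phi> s t else 0)) (at_right t)"
    using deriv[of t] t by (simp only: s_def atLeastLessThan_iff simp_thms)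
  ultimately show "\<exists>D\<ge>- (k + \<delta> / \<sigma>) * \<eta> t. (\<eta> has_real_derivative D) (at_right t)"
    by blast
qed fact+

lemma triggered_gap:
  obtains \<delta> where "0 < \<delta>" "\<And>s t. 0 \<le> s \<Longrightarrow> s < t \<Longrightarrow> t < T \<Longrightarrow> triggered i s t \<Longrightarrow> s + \<delta> \<le> t"
proof -
  obtain K where K: "0 \<le> K"
    "\<And>i s t. 0 \<le> s \<Longrightarrow> s \<le> t \<Longrightarrow> t < T \<Longrightarrow> g_fun i s t \<le> K * (t - s)\<^sup>2"
    "\<And>i s t. 0 \<le> s \<Longrightarrow> s \<le> t \<Longrightarrow> t < T \<Longrightarrow> h_fun i s t \<le> K * (t - s)\<^sup>2"
    using trigger_functions_le by blast
  have reset: "g_fun i t t \<le> 0" "h_fun i t t \<le> 0" if "t \<in> {0..<T}" for t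
    using K(2)[of t t i] K(3)[of t t i] that by auto
  have eqs: eta_equations
    using execution by (simp add: execution_def)
  have par: "0 < sigma_g (ag i)" "0 < sigma_h (ag i)" "0 < k_g (ag i)" "0 < k_h (ag i)"
    "0 \<le> delta_g (ag i)" "0 \<le> delta_h (ag i)"
    using trigger[of i] by (auto simp: trigger_parameters_def)
  have "\<exists>m>0. \<forall>t. 0 \<le> t \<longrightarrow> t < T \<longrightarrow> m \<le> eta_g X i t"
    by (rule threshold_lower_bound[where k = "k_g (ag i)" and \<delta> = "delta_g (ag i)"
          and \<sigma> = "sigma_g (ag i)" and \<phi> = "g_fun i" and i = i])
      (use eqs par reset in \<open>auto simp: eta_equations_def Let_def life_eq triggered_def\<close>)
  moreover have "\<exists>m>0. \<forall>t. 0 \<le> t \<longrightarrow> t < T \<longrightarrow> m \<le> eta_h X i t"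
    by (rule threshold_lower_bound[where k = "k_h (ag i)" and \<delta> = "delta_h (ag i)"
          and \<sigma> = "sigma_h (ag i)" and \<phi> = "h_fun i" and i = i])
      (use eqs par reset in \<open>auto simp: eta_equations_def Let_def life_eq triggered_def\<close>)
  ultimately obtain mg mh where m0: "0 < mg" "0 < mh"
    and m1: "\<And>t. 0 \<le> t \<Longrightarrow> t < T \<Longrightarrow> mg \<le> eta_g X i t" "\<And>t. 0 \<le> t \<Longrightarrow> t < T \<Longrightarrow> mh \<le> eta_h X i t"
    by blast
  define m where "m = min mg mh"
  define \<sigma> where "\<sigma> = max (sigma_g (ag i)) (sigma_h (ag i))"
  \<comment> \<open>Chosen so that the quadratic bound at distance \<open>\<delta>\<close> stays
    below the least threshold \<open>m\<close>; the summand 1 makes this strict and also covers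
    \<open>K = 0\<close>.\<close>
  define \<delta> where "\<delta> = sqrt (m / (\<sigma> * K + 1))"
  have pos: "0 < m" "0 < \<sigma>" "0 < \<sigma> * K + 1"
    using m0 par K(1) by (auto simp: m_def \<sigma>_def less_max_iff_disj intro!: add_nonneg_pos mult_nonneg_nonneg)
  have \<delta>: "0 < \<delta>" "\<sigma> * K * \<delta>\<^sup>2 < m"
    using pos by (auto simp: \<delta>_def field_simps)
  show thesis
  proof (rule that[OF \<delta>(1)])
    fix s t assume st: "0 \<le> s" "s < t" "t < T" and trig: "triggered i s t"
    \<comment> \<open>The value \<open>y\<close> may be negative, so it is replaced by its
      nonnegative bound before the factor \<open>c\<close> is enlarged to
      \<open>\<sigma>\<close>.\<close>
    have scaled: "c * y \<le> \<sigma> * K * (t - s)\<^sup>2" if "y \<le> K * (t - s)\<^sup>2" "0 < c" "c \<le> \<sigma>" for c y :: real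
    proof -
      have "c * y \<le> c * (K * (t - s)\<^sup>2)"
        using that by (intro mult_left_mono) auto
      also have "\<dots> \<le> \<sigma> * (K * (t - s)\<^sup>2)"
        using that K(1) by (intro mult_right_mono) auto
      finally show ?thesis
        by (simp add: mult.assoc)
    qed
    have "m \<le> \<sigma> * K * (t - s)\<^sup>2"
      using trig scaled[of "g_fun i s t" "sigma_g (ag i)"] scaled[of "h_fun i s t" "sigma_h (ag i)"]
        K(2)[of s t i] K(3)[of s t i] m1[of t] st par
      by (auto simp: triggered_def m_def \<sigma>_def)
    show "s + \<delta> \<le> t"
    proof (rule ccontr)
      assume "\<not> s + \<delta> \<le> t"
      then have "(t - s)\<^sup>2 \<le> \<delta>\<^sup>2"
        using st by (intro power_mono) auto
      then have "\<sigma> * K * (t - s)\<^sup>2 \<le> \<sigma> * K * \<delta>\<^sup>2"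
        using pos K(1) by (intro mult_left_mono) auto
      then show False
        using \<delta>(2) \<open>m \<le> _\<close> by simp
    qed
  qed
qed

section \<open>Uniform spacing of the attempts and its consequence for a finite horizon\<close>

lemma attempt_gap:
  obtains \<delta> where "0 < \<delta>"
    "\<And>k. attempt X i k < horizon X \<Longrightarrow> attempt X i k + ereal \<delta> \<le> attempt X i (Suc k)"
proof -
  obtain \<delta> where \<delta>: "0 < \<delta>" "\<And>s t. 0 \<le> s \<Longrightarrow> s < t \<Longrightarrow> t < T \<Longrightarrow> triggered i s t \<Longrightarrow> s + \<delta> \<le> t"
    using triggered_gap[of i] by blast
  obtain \<kappa> where \<kappa>: "0 < \<kappa>" "\<And>k. \<kappa> \<le> dwell (ag i) k"
    using trigger[of i] by (auto simp: trigger_parameters_def)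
  show thesis
  proof (rule that[of "min \<delta> \<kappa>"])
    show "0 < min \<delta> \<kappa>"
      using \<delta>(1) \<kappa>(1) by simp
    fix k assume k: "attempt X i k < horizon X"
    then obtain s where s: "attempt X i k = ereal s" "0 \<le> s"
      using attempt_nonneg[of i k] by (cases "attempt X i k") (auto simp: horizon)
    show "attempt X i k + ereal (min \<delta> \<kappa>) \<le> attempt X i (Suc k)"
    proof (cases "secure s s")
      case True
      then have "attempt X i (Suc k) = Inf (ereal ` {t \<in> life X. s < t \<and> triggered i s t})"
        using attempt_Suc(2)[OF k] s by (simp add: next_attempt_def)
      \<comment> \<open>If no trigger occurs the set is empty and its infimum is
        \<open>\<infinity>\<close>, so the estimate covers this case too.\<close>
      also have "ereal (s + min \<delta> \<kappa>) \<le> \<dots>"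
        using \<delta>(2)[OF s(2)] by (intro Inf_greatest) (force simp: life_eq)
      finally show ?thesis
        unfolding s(1) plus_ereal.simps .
    next
      case False
      then have "attempt X i (Suc k) = ereal (s + dwell (ag i) k)"
        using attempt_Suc(2)[OF k] s by (simp add: next_attempt_def)
      then show ?thesis
        unfolding s(1) plus_ereal.simps using \<kappa>(2)[of k] by (simp del: ereal_min)
    qed
  qed
qed

lemma attempts_beyond_horizon: "\<exists>k. horizon X \<le> attempt X i k"
proof (rule ccontr)
  assume "\<not> ?thesis"
  then have less: "attempt X i k < horizon X" for k
    by (simp add: not_le)
  obtain \<delta> where \<delta>: "0 < \<delta>"
    "\<And>k. attempt X i k < horizon X \<Longrightarrow> attempt X i k + ereal \<delta> \<le> attempt X i (Suc k)"
    using attempt_gap[of i] by blast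
  have ge: "ereal (of_nat k * \<delta>) \<le> attempt X i k" for k
  proof (induction k)
    case 0
    then show ?case
      by (simp add: attempt_0)
  next
    case (Suc k)
    have "ereal (of_nat (Suc k) * \<delta>) = ereal (of_nat k * \<delta>) + ereal \<delta>"
      by (simp add: algebra_simps)
    also have "\<dots> \<le> attempt X i k + ereal \<delta>"
      using Suc by (intro add_right_mono)
    also have "\<dots> \<le> attempt X i (Suc k)"
      by (rule \<delta>(2)[OF less])
    finally show ?case .
  qed
  obtain k :: nat where "T < of_nat k * \<delta>"
    using reals_Archimedean3[OF \<delta>(1)] by blast
  then have "T < T"
    using order.strict_trans1[OF ge[of k] less[of k]] by (simp add: horizon)
  then show False
    by simp
qed

end

section \<open>Exclusion of Zeno behaviour for an arbitrary horizon\<close>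

context dos_execution
begin

theorem not_zeno: "\<not> zeno (attempt X i)"
proof
  assume "zeno (attempt X i)"
  then obtain T0 where lim: "attempt X i \<longlonglongrightarrow> ereal T0"
    by (auto simp: zeno_def)
  have le: "attempt X i k \<le> ereal T0" for k
    using attempt_mono lim by (intro incseq_le) (auto simp: incseq_def)
  \<comment> \<open>An attempt at or past the horizon would make the next one
    \<open>\<infinity>\<close>, above the finite limit \<open>T0\<close>.\<close>
  have less: "attempt X i k < horizon X" for k
  proof (rule ccontr)
    assume "\<not> attempt X i k < horizon X"
    then show False
      using le[of "Suc k"] by (simp add: attempt_Suc_infinity)
  qed
  \<comment> \<open>If the solution lived at \<open>T0\<close>, the covering property would provide
    an attempt later than \<open>T0\<close>, though all of them are at most their limit. Hence the
    horizon is finite.\<close>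
  have "\<not> ereal T0 < horizon X"
  proof
    assume "ereal T0 < horizon X"
    then have "T0 \<in> life X"
      using le[of 0] by (simp add: life_def attempt_0)
    then obtain k where "ereal T0 < attempt X i (Suc k)"
      using attempt_covers by blast
    then show False
      using le[of "Suc k"] by simp
  qed
  then obtain T where "horizon X = ereal T"
    using execution by (cases "horizon X") (auto simp: execution_def)
  then interpret finite_dos_execution q ag \<alpha> \<beta> E a r \<Xi> X T
    by unfold_locales
  show False
    using attempts_beyond_horizon[of i] less by (meson leD)
qed

end

theorem theorem3:
  fixes M :: "'w measure"
    and r :: "real \<Rightarrow> 'w \<Rightarrow> 's::finite"
    and q :: nat
    and ag :: "'v::finite \<Rightarrow> agent"
    and \<alpha> \<beta> :: real
    and E :: "'s \<Rightarrow> ('v \<times> 'v) set"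
    and a :: "'s \<Rightarrow> 'v \<Rightarrow> 'v \<Rightarrow> real"
    and m :: enat
    and onset dur :: "nat \<Rightarrow> real"
    and X :: "'w \<Rightarrow> 'v trajectory"
  assumes plant: "\<And>i. agent_plant q (ag i)"
    and feedback: "\<And>i. agent_feedback q (ag i)"
    and gains: "\<alpha> > 0" "\<beta> > 0"
    and minimizer: "has_minimizer q ag"
    and costs: "\<And>i. cost_regular q (ag i)"
    and digraphs: "weighted_digraphs E a"
    and markov: "homogeneous_markov M r" "right_continuous_paths M r"
    and kernel: "\<exists>\<pi>::'v \<Rightarrow> real. (\<forall>i. \<pi> i > 0) \<and>
      (\<forall>\<omega>\<in>space M. \<forall>t\<ge>0. \<forall>i. (\<Sum>j\<in>UNIV. laplacian (a (r t \<omega>)) i j * \<pi> j) = 0)"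
    and cuts: "\<exists>c>0. \<forall>S::'v set. S \<noteq> {} \<and> S \<noteq> UNIV \<longrightarrow>
      (\<Sum>i\<in>S. \<Sum>j\<in>-S. - sym_laplacian a i j) \<ge> c"
    and attacks: "dos_attacks m onset dur"
    and trigger: "\<And>i. trigger_parameters (ag i)"
    and dynamics: "\<And>\<omega>. \<omega> \<in> space M \<Longrightarrow>
      closed_loop.execution q ag \<alpha> \<beta> E a (\<lambda>t. r t \<omega>) (Xi_a m onset dur) (X \<omega>)"
  shows "\<forall>\<omega>\<in>space M. \<forall>i. \<not> zeno (attempt (X \<omega>) i)"
proof (intro ballI allI)
  fix \<omega> i assume \<omega>: "\<omega> \<in> space M"
  interpret dos_execution q ag \<alpha> \<beta> E a "\<lambda>t. r t \<omega>" "Xi_a m onset dur" "X \<omega>"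
  proof (unfold_locales; (rule plant feedback costs trigger dynamics[OF \<omega>])?)
    \<comment> \<open>The second time argument of \<open>Xi_a\<close> only truncates the attack set
      to \<open>[0, t]\<close>, so membership of \<open>s\<close> is unaffected as long as
      \<open>s \<le> t\<close>.\<close>
    show "closed_loop.secure (Xi_a m onset dur) s t \<longleftrightarrow> closed_loop.secure (Xi_a m onset dur) s s"
      if "0 \<le> s" "s \<le> t" for s t
      using that by (auto simp: closed_loop.secure_def Xi_a_def)
  qed
  show "\<not> zeno (attempt (X \<omega>) i)"
    by (rule not_zeno)
qed

end
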